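(* Let $S_1,\dots,S_n\in\mathbb R^p$ be deterministic vectors, let $N_1,\dots,N_n$ be independent random vectors with $N_i\sim\mathcal N(0,\Sigma_i)$, and set $I_i=S_i+N_i$. Let $\mathcal T$ be a finite set of $p\times p$ matrices containing $\mathrm I_p$. For $O\in\mathcal T$ set $d^2_{ij,\mathrm{noisy}}(O)=\|I_i-OI_j\|^2$ and $d^2_{ij,\mathrm{clean}}(O)=\|S_i-OS_j\|^2$. Let $t_p:=\sup_i\sup_{O\in\mathcal T}\sqrt{\mathrm{trace}((O\Sigma_iO^T)^2)}$ and $s_p:=\sup_{1\le i\le n}\sup_{O\in\mathcal T}\sqrt{\|O\Sigma_iO^T\|_{op}}$. Then $$\sup_{O\in\mathcal T}\sup_{i\ne j}\big|d^2_{ij,\mathrm{noisy}}(O)-d^2_{ij,\mathrm{clean}}(O)-\mathrm{trace}(\Sigma_i+O\Sigma_jO^T)\big| =O_P\Big(\sqrt{\log[|\mathcal T|n^2]}\big(t_p+s_p\sup_{i,O\in\mathcal T}\|OS_i\|\big)+\log[|\mathcal T|n^2]\,s_p^2\Big).$$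
   Context: All quantities ($n$, $p$, $S_i$, $\Sigma_i$, $\mathcal T$) may depend on the asymptotic index, with $n,p\to\infty$. For random variables $X$ and positive deterministic $a$, $X=O_P(a)$ means: for every $\delta>0$ there is $K$ such that $P(|X|>Ka)<\delta$ for all sufficiently large $n,p$. $|\mathcal T|$ is the cardinality of $\mathcal T$, $\|\cdot\|$ the Euclidean norm, $\|\cdot\|_{op}$ the operator norm. *)

theory Defs
  imports "HOL-Probability.Probability"
begin

text \<open>Vectors in R^p are functions nat => real (only indices < p matter);
  p x p matrices are functions nat => nat => real.\<close>

definition vnorm :: "nat \<Rightarrow> (nat \<Rightarrow> real) \<Rightarrow> real" where
  "vnorm p x = sqrt (\<Sum>j<p. (x j)^2)"

definition mvmult :: "nat \<Rightarrow> (nat \<Rightarrow> nat \<Rightarrow> real) \<Rightarrow> (nat \<Rightarrow> real) \<Rightarrow> (nat \<Rightarrow> real)" where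
  "mvmult p A x = (\<lambda>a. \<Sum>b<p. A a b * x b)"

definition mmult :: "nat \<Rightarrow> (nat \<Rightarrow> nat \<Rightarrow> real) \<Rightarrow> (nat \<Rightarrow> nat \<Rightarrow> real) \<Rightarrow> (nat \<Rightarrow> nat \<Rightarrow> real)" where
  "mmult p A B = (\<lambda>a b. if a < p \<and> b < p then (\<Sum>c<p. A a c * B c b) else 0)"

definition mtrans :: "(nat \<Rightarrow> nat \<Rightarrow> real) \<Rightarrow> (nat \<Rightarrow> nat \<Rightarrow> real)" where
  "mtrans A = (\<lambda>a b. A b a)"

definition mtrace :: "nat \<Rightarrow> (nat \<Rightarrow> nat \<Rightarrow> real) \<Rightarrow> real" where
  "mtrace p A = (\<Sum>a<p. A a a)"

definition idm :: "nat \<Rightarrow> (nat \<Rightarrow> nat \<Rightarrow> real)" where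
  "idm p = (\<lambda>a b. if a = b \<and> a < p then 1 else 0)"

definition opnorm :: "nat \<Rightarrow> (nat \<Rightarrow> nat \<Rightarrow> real) \<Rightarrow> real" where
  "opnorm p A = Sup {vnorm p (mvmult p A x) | x. vnorm p x \<le> 1}"

definition is_mat :: "nat \<Rightarrow> (nat \<Rightarrow> nat \<Rightarrow> real) \<Rightarrow> bool" where
  "is_mat p A \<longleftrightarrow> (\<forall>a b. (p \<le> a \<or> p \<le> b) \<longrightarrow> A a b = 0)"

definition sym_psd :: "nat \<Rightarrow> (nat \<Rightarrow> nat \<Rightarrow> real) \<Rightarrow> bool" where
  "sym_psd p A \<longleftrightarrow> (\<forall>a<p. \<forall>b<p. A a b = A b a) \<and>
     (\<forall>u. 0 \<le> (\<Sum>a<p. \<Sum>b<p. u a * A a b * u b))"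

text \<open>X = (X 0, ..., X (p-1)) is a centred Gaussian vector with covariance Sig:
  every linear combination u.X is N(0, u^T Sig u) (variance 0: point mass at 0).\<close>
definition gaussian_vec :: "'a measure \<Rightarrow> nat \<Rightarrow> (nat \<Rightarrow> 'a \<Rightarrow> real) \<Rightarrow> (nat \<Rightarrow> nat \<Rightarrow> real) \<Rightarrow> bool" where
  "gaussian_vec M p X Sig \<longleftrightarrow> (\<forall>j<p. X j \<in> borel_measurable M) \<and>
     (\<forall>u. let v = (\<Sum>a<p. \<Sum>b<p. u a * Sig a b * u b) in
        (if v = 0 then (AE \<omega> in M. (\<Sum>j<p. u j * X j \<omega>) = 0)
         else distributed M lborel (\<lambda>\<omega>. \<Sum>j<p. u j * X j \<omega>)
                (\<lambda>x. ennreal (normal_density 0 (sqrt v) x))))"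

definition bigOP :: "(nat \<Rightarrow> 'a measure) \<Rightarrow> (nat \<Rightarrow> 'a \<Rightarrow> real) \<Rightarrow> (nat \<Rightarrow> real) \<Rightarrow> bool" where
  "bigOP M X a \<longleftrightarrow> (\<forall>\<delta>>0. \<exists>K. eventually
      (\<lambda>m. measure (M m) {\<omega> \<in> space (M m). \<bar>X m \<omega>\<bar> > K * a m} < \<delta>) sequentially)"

end

theory Submission
  imports Defs "HOL-Real_Asymp.Real_Asymp"
begin

text \<open>For fixed \<open>O\<close> and \<open>i \<noteq> j\<close> put \<open>s = S\<^sub>i - O S\<^sub>j\<close> and \<open>Z = N\<^sub>i - O N\<^sub>j\<close>, a centred Gaussian vector with
  covariance \<open>C = \<Sigma>\<^sub>i + O \<Sigma>\<^sub>j O\<^sup>T\<close>. The deviation is \<open>2 s \<bullet> Z + (|Z|\<^sup>2 - trace C)\<close>: a Gaussian variable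
  plus a centred Gaussian quadratic form. In an orthonormal eigenbasis of \<open>C\<close> with eigenvalues \<open>c\<^sub>k\<close>,
  the Laplace transform of \<open>|Z|\<^sup>2\<close> is \<open>\<Prod>k. (1 - 2 \<theta> c\<^sub>k) powr (- 1/2)\<close>, so both summands satisfy
  \<open>E exp (\<theta> X) \<le> exp (4 \<theta>\<^sup>2 F\<^sup>2)\<close> for \<open>4 |\<theta>| max c\<^sub>k \<le> 1\<close>, with \<open>F \<le> 2 t\<^sub>p\<close> for the quadratic form and
  \<open>F \<le> 2 s\<^sub>p sup |O S\<^sub>i|\<close> for the linear one. With \<open>L = log (|T| n\<^sup>2)\<close>, Markov's inequality gives tails of
  order \<open>exp (- 8 L)\<close> at the stated scale, which beats the union bound over at most \<open>exp L\<close> triples.\<close>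

section \<open>Diagonalisation of symmetric matrices\<close>

definition bform :: "nat \<Rightarrow> (nat \<Rightarrow> nat \<Rightarrow> real) \<Rightarrow> (nat \<Rightarrow> real) \<Rightarrow> (nat \<Rightarrow> real) \<Rightarrow> real" where
  "bform p A x y = (\<Sum>a<p. \<Sum>b<p. x a * A a b * y b)"

definition sym_mat :: "nat \<Rightarrow> (nat \<Rightarrow> nat \<Rightarrow> real) \<Rightarrow> bool" where
  "sym_mat p A \<longleftrightarrow> (\<forall>a<p. \<forall>b<p. A a b = A b a)"

text \<open>The basis vectors are the rows \<open>u k\<close>. The row relations express
  orthonormality, the column relations completeness; carrying both makes Parseval's identity
  available with no dimension argument.\<close>

definition orthonormal :: "nat \<Rightarrow> (nat \<Rightarrow> nat \<Rightarrow> real) \<Rightarrow> bool" where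
  "orthonormal p u \<longleftrightarrow>
     (\<forall>k<p. \<forall>l<p. (\<Sum>a<p. u k a * u l a) = (if k = l then 1 else 0)) \<and>
     (\<forall>a<p. \<forall>b<p. (\<Sum>k<p. u k a * u k b) = (if a = b then 1 else 0))"

lemma orthonormal_row:
  "orthonormal p u \<Longrightarrow> k < p \<Longrightarrow> l < p \<Longrightarrow> (\<Sum>a<p. u k a * u l a) = (if k = l then 1 else 0)"
  by (simp add: orthonormal_def)

lemma orthonormal_column:
  "orthonormal p u \<Longrightarrow> a < p \<Longrightarrow> b < p \<Longrightarrow> (\<Sum>k<p. u k a * u k b) = (if a = b then 1 else 0)"
  by (simp add: orthonormal_def)

section \<open>Algebra of bilinear forms\<close>

lemma bform_sym: "sym_mat p A \<Longrightarrow> bform p A x y = bform p A y x"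
  unfolding bform_def sym_mat_def
  by (subst sum.swap) (auto intro!: sum.cong simp: mult.commute mult.left_commute)

lemma bform_add_left: "bform p A (\<lambda>a. x a + y a) z = bform p A x z + bform p A y z"
  by (simp add: bform_def algebra_simps sum.distrib)

lemma bform_add_right: "bform p A z (\<lambda>a. x a + y a) = bform p A z x + bform p A z y"
  by (simp add: bform_def algebra_simps sum.distrib)

lemma bform_diff_left: "bform p A (\<lambda>a. x a - y a) z = bform p A x z - bform p A y z"
  by (simp add: bform_def algebra_simps sum_subtractf)

lemma bform_diff_right: "bform p A z (\<lambda>a. x a - y a) = bform p A z x - bform p A z y"
  by (simp add: bform_def algebra_simps sum_subtractf)

lemma bform_scale_left: "bform p A (\<lambda>a. r * x a) z = r * bform p A x z"
  by (simp add: bform_def sum_distrib_left mult.assoc)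

lemma bform_scale_right: "bform p A z (\<lambda>a. r * x a) = r * bform p A z x"
  by (simp add: bform_def sum_distrib_left mult_ac)

lemma bform_sum_left: "bform p A (\<lambda>a. \<Sum>k\<in>I. x k a) z = (\<Sum>k\<in>I. bform p A (x k) z)"
  unfolding bform_def sum_distrib_right
  by (subst (2) sum.swap, subst (1) sum.swap) (simp add: sum.swap[of _ _ I])

lemma bform_sum_right: "bform p A z (\<lambda>a. \<Sum>k\<in>I. x k a) = (\<Sum>k\<in>I. bform p A z (x k))"
  unfolding bform_def sum_distrib_left
  by (simp add: sum.swap[of _ _ I])

lemma bform_cong:
  "(\<And>a b. a < p \<Longrightarrow> b < p \<Longrightarrow> A a b = B a b) \<Longrightarrow> (\<And>a. a < p \<Longrightarrow> x a = x' a) \<Longrightarrow>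
    (\<And>a. a < p \<Longrightarrow> y a = y' a) \<Longrightarrow> bform p A x y = bform p B x' y'"
  unfolding bform_def by (intro sum.cong refl) auto

section \<open>Plane rotations and extremal orthonormal frames\<close>

lemma sum_change_two:
  fixes g h :: "nat \<Rightarrow> real"
  assumes "finite I" "k \<in> I" "l \<in> I" "k \<noteq> l" "\<And>m. m \<in> I \<Longrightarrow> m \<noteq> k \<Longrightarrow> m \<noteq> l \<Longrightarrow> g m = h m"
  shows "sum g I = sum h I + (g k + g l - h k - h l)"
proof -
  have "sum g (I - {k} - {l}) = sum h (I - {k} - {l})"
    using assms(5) by (intro sum.cong) auto
  moreover have "sum f I = f k + (f l + sum f (I - {k} - {l}))" for f :: "nat \<Rightarrow> real"
    using assms by (subst sum.remove[of I k f], simp, simp, subst sum.remove[of "I - {k}" l f]) auto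
  ultimately show ?thesis by simp
qed

text \<open>A Givens rotation acting from the left in the plane of rows \<open>k\<close> and
  \<open>l\<close>, with \<open>c\<close> and \<open>s\<close> as cosine and sine. Only these two
  rows change, so sums over rows are compared through \<open>sum_change_two\<close>.\<close>

definition rotate_rows :: "nat \<Rightarrow> nat \<Rightarrow> real \<Rightarrow> real \<Rightarrow> (nat \<Rightarrow> nat \<Rightarrow> real) \<Rightarrow> nat \<Rightarrow> nat \<Rightarrow> real" where
  "rotate_rows k l c s u = u(k := (\<lambda>a. c * u k a + s * u l a), l := (\<lambda>a. - s * u k a + c * u l a))"

lemma orthonormal_rotate_rows:
  assumes u: "orthonormal p u" and kl: "k < p" "l < p" "k \<noteq> l" and cs: "c\<^sup>2 + s\<^sup>2 = 1"
  shows "orthonormal p (rotate_rows k l c s u)"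
proof -
  let ?v = "rotate_rows k l c s u"
  define dot where "dot x y = (\<Sum>a<p. x a * y a)" for x y :: "nat \<Rightarrow> real"
  have dot_lin: "dot (\<lambda>a. r * x a + t * y a) z = r * dot x z + t * dot y z"
      "dot z (\<lambda>a. r * x a + t * y a) = r * dot z x + t * dot z y" for r t x y z
    by (simp_all add: dot_def sum.distrib sum_distrib_left algebra_simps)
  have dot_u: "dot (u m) (u m') = (if m = m' then 1 else 0)" if "m < p" "m' < p" for m m'
    using orthonormal_row[OF u that] by (simp add: dot_def)
  have cs': "c * c + s * s = 1" using cs by (simp add: power2_eq_square)
  have "dot (?v m) (?v m') = (if m = m' then 1 else 0)" if "m < p" "m' < p" for m m'
    unfolding rotate_rows_def using kl that cs'
    by (auto simp: dot_lin dot_lin[where r = "- s", simplified] dot_u algebra_simps)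
  moreover have "(\<Sum>m<p. ?v m a * ?v m b) = (if a = b then 1 else 0)" if "a < p" "b < p" for a b
  proof -
    have "(\<Sum>m<p. ?v m a * ?v m b) = (\<Sum>m<p. u m a * u m b) +
        (?v k a * ?v k b + ?v l a * ?v l b - u k a * u k b - u l a * u l b)"
      by (rule sum_change_two) (use kl in \<open>auto simp: rotate_rows_def\<close>)
    \<comment> \<open>The mixed terms carrying \<open>c * s\<close> cancel between the two rotated
      rows.\<close>
    also have "?v k a * ?v k b + ?v l a * ?v l b = (c * c + s * s) * (u k a * u k b + u l a * u l b)"
      using kl by (simp add: rotate_rows_def algebra_simps)
    finally show ?thesis using orthonormal_column[OF u that] cs' by simp
  qed
  ultimately show ?thesis by (simp add: orthonormal_def dot_def)
qed

text \<open>By Tychonoff the functions with all entries in \<open>{-1..1}\<close> are compact in the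
  product topology, and orthonormality is a closed condition, so a continuous \<open>f\<close>
  attains its maximum over frames. \<open>local\<close> says that \<open>f\<close> sees only indices
  below \<open>p\<close>.\<close>

lemma orthonormal_max:
  fixes f :: "(nat \<Rightarrow> nat \<Rightarrow> real) \<Rightarrow> real"
  assumes cont: "continuous_on UNIV (\<lambda>w. f (\<lambda>k a. w (k, a)))"
    and local: "\<And>u v. (\<And>k a. k < p \<Longrightarrow> a < p \<Longrightarrow> u k a = v k a) \<Longrightarrow> f u = f v"
  obtains u where "orthonormal p u" "\<And>v. orthonormal p v \<Longrightarrow> f v \<le> f u"
proof -
  define K where "K = PiE UNIV (\<lambda>_::nat \<times> nat. {-1..1::real}) \<inter> {w. orthonormal p (\<lambda>k a. w (k, a))}"
  have "compactin (product_topology (\<lambda>_. euclidean) UNIV) (PiE UNIV (\<lambda>_::nat \<times> nat. {-1..1::real}))"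
    by (subst compactin_PiE) auto
  then have cmp: "compact (PiE UNIV (\<lambda>_::nat \<times> nat. {-1..1::real}))"
    by (simp add: euclidean_product_topology)
  have co: "continuous_on UNIV (\<lambda>w :: nat \<times> nat \<Rightarrow> real. w x)" for x
    by simp
  have "closed {w :: nat \<times> nat \<Rightarrow> real. orthonormal p (\<lambda>k a. w (k, a))}"
    unfolding orthonormal_def
    by (intro closed_Collect_conj closed_Collect_all closed_Collect_imp closed_Collect_eq
        continuous_intros co open_Collect_const) 
  then have "compact K" unfolding K_def by (intro compact_Int_closed cmp)
  moreover have "(\<lambda>(k, a). if k = a then 1 else 0) \<in> K"
    by (auto simp: K_def orthonormal_def if_distrib if_distribR cong: if_cong)
  moreover have "continuous_on K (\<lambda>w. f (\<lambda>k a. w (k, a)))"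
    using cont continuous_on_subset by blast
  ultimately obtain w where w: "w \<in> K" "\<And>v. v \<in> K \<Longrightarrow> f (\<lambda>k a. v (k, a)) \<le> f (\<lambda>k a. w (k, a))"
    using continuous_attains_sup[of K "\<lambda>w. f (\<lambda>k a. w (k, a))"] by blast
  show ?thesis
  proof
    show "orthonormal p (\<lambda>k a. w (k, a))" using w by (simp add: K_def)
    fix v assume v: "orthonormal p v"
    \<comment> \<open>An arbitrary frame may have large entries outside the \<open>p\<close> by
      \<open>p\<close> block. Its truncation lies in \<open>K\<close>, and by \<open>local\<close>
      it has the same value of \<open>f\<close>.\<close>
    let ?v = "\<lambda>(k, a). if k < p \<and> a < p then v k a else 0"
    have le1: "\<bar>v k a\<bar> \<le> 1" if "k < p" "a < p" for k a
    proof -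
      have "(v k a)\<^sup>2 \<le> (\<Sum>a<p. (v k a)\<^sup>2)"
        by (rule member_le_sum) (use that in auto)
      also have "\<dots> = 1" using orthonormal_row[OF v that(1) that(1)] by (simp add: power2_eq_square)
      finally show ?thesis by (simp add: abs_square_le_1)
    qed
    have "orthonormal p (\<lambda>k a. ?v (k, a))"
      using v unfolding orthonormal_def by simp
    with le1 have "?v \<in> K" by (auto simp: K_def abs_le_iff)
    from w(2)[OF this] show "f v \<le> f (\<lambda>k a. w (k, a))"
      using local[of v "\<lambda>k a. ?v (k, a)"] by simp
  qed
qed

text \<open>First-order condition at the maximiser \<open>t = 0\<close>. If \<beta> were nonzero, a
  small \<open>t\<close> of the same sign would let the linear term win: at
  \<open>t = \<beta> / M\<close> with \<open>M\<close> above |\<alpha>| the value is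
  positive.\<close>

lemma quadratic_nonpos_imp_linear_zero:
  fixes \<alpha> \<beta> :: real
  assumes "\<And>t. \<alpha> * t\<^sup>2 + \<beta> * t \<le> 0"
  shows "\<beta> = 0"
proof (rule ccontr)
  assume b: "\<beta> \<noteq> 0"
  define M where "M = 1 + \<bar>\<alpha>\<bar>"
  have M: "M > 0" "\<alpha> > - M" by (auto simp: M_def)
  have "\<alpha> * (\<beta> / M)\<^sup>2 + \<beta> * (\<beta> / M) = \<beta>\<^sup>2 / M\<^sup>2 * (\<alpha> + M)"
    using M by (simp add: field_simps power2_eq_square)
  moreover have "\<dots> > 0" using M b by (intro mult_pos_pos) auto
  ultimately show False using assms[of "\<beta> / M"] by linarith
qed

text \<open>An orthonormal frame \<open>u\<close> maximising \<open>\<Sum>k. k * u\<^sub>k\<^sup>T A u\<^sub>k\<close> is stationary under rotations in each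
  coordinate plane, which forces the off-diagonal entries \<open>u\<^sub>k\<^sup>T A u\<^sub>l\<close> to vanish.\<close>

lemma symmetric_diagonalizable:
  assumes A: "sym_mat p A"
  obtains u where "orthonormal p u" "\<And>k l. k < p \<Longrightarrow> l < p \<Longrightarrow> k \<noteq> l \<Longrightarrow> bform p A (u k) (u l) = 0"
proof -
  \<comment> \<open>The weights \<open>real k\<close> are pairwise distinct, which makes the factor
    \<open>w\<close> below nonzero. With equal weights \<open>f\<close> would be a multiple of the
    trace and rotations would reveal nothing.\<close>
  define f where "f u = (\<Sum>k<p. real k * bform p A (u k) (u k))" for u
  have co: "continuous_on UNIV (\<lambda>w :: nat \<times> nat \<Rightarrow> real. w x)" for x
    by simp
  obtain u where u: "orthonormal p u" and max: "\<And>v. orthonormal p v \<Longrightarrow> f v \<le> f u"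
  proof (rule orthonormal_max[where f = f and p = p])
    show "continuous_on UNIV (\<lambda>w. f (\<lambda>k a. w (k, a)))"
      unfolding f_def bform_def by (intro continuous_intros co)
    show "f u = f v" if "\<And>k a. k < p \<Longrightarrow> a < p \<Longrightarrow> u k a = v k a" for u v
      using that unfolding f_def by (intro sum.cong refl arg_cong2[where f = "(*)"] bform_cong) auto
  qed auto
  show ?thesis
  proof
    show "orthonormal p u" by (rule u)
    fix k l assume kl: "k < p" "l < p" "k \<noteq> l"
    define \<alpha> where "\<alpha> = bform p A (u k) (u k)"
    define \<beta> where "\<beta> = bform p A (u k) (u l)"
    define \<gamma> where "\<gamma> = bform p A (u l) (u l)"
    define w where "w = real k - real l"
    have \<beta>': "bform p A (u l) (u k) = \<beta>" using bform_sym[OF A] by (simp add: \<beta>_def)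
    have "w * (\<gamma> - \<alpha>) * t\<^sup>2 + 2 * w * \<beta> * t \<le> 0" for t
    proof -
      \<comment> \<open>The rotation angle is parametrised by its tangent \<open>t\<close>.
        Eliminating \<open>c\<close> through \<open>c\<^sup>2 = 1 - s\<^sup>2\<close> removes the
        constant terms, and multiplying by \<open>r\<^sup>2\<close> leaves a quadratic polynomial in
        \<open>t\<close>.\<close>
      define r where "r = sqrt (1 + t\<^sup>2)"
      have r: "r > 0" "r\<^sup>2 = 1 + t\<^sup>2" by (auto simp: r_def add_pos_nonneg)
      define c s where "c = 1 / r" and "s = t / r"
      have cs: "c\<^sup>2 + s\<^sup>2 = 1" using r
        by (simp add: c_def s_def power_divide flip: add_divide_distrib) (simp flip: r(2))
      let ?v = "rotate_rows k l c s u"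
      have vk: "bform p A (?v k) (?v k) = c\<^sup>2 * \<alpha> + 2 * c * s * \<beta> + s\<^sup>2 * \<gamma>"
        using kl \<beta>' unfolding rotate_rows_def
        by (simp add: bform_add_left bform_add_right bform_scale_left bform_scale_right
            \<alpha>_def \<beta>_def \<gamma>_def algebra_simps power2_eq_square)
      have vl: "bform p A (?v l) (?v l) = s\<^sup>2 * \<alpha> - 2 * c * s * \<beta> + c\<^sup>2 * \<gamma>"
        using kl \<beta>' unfolding rotate_rows_def
        by (simp add: bform_add_left bform_add_right bform_scale_left bform_scale_right
            bform_diff_left bform_diff_right
            \<alpha>_def \<beta>_def \<gamma>_def algebra_simps power2_eq_square)
      have "f ?v = f u + (k * bform p A (?v k) (?v k) + l * bform p A (?v l) (?v l) - k * \<alpha> - l * \<gamma>)"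
        unfolding f_def \<alpha>_def \<gamma>_def
        by (rule sum_change_two) (use kl in \<open>auto simp: rotate_rows_def\<close>)
      then have "k * (c\<^sup>2 * \<alpha> + 2 * c * s * \<beta> + s\<^sup>2 * \<gamma>) + l * (s\<^sup>2 * \<alpha> - 2 * c * s * \<beta> + c\<^sup>2 * \<gamma>)
          - k * \<alpha> - l * \<gamma> \<le> 0"
        using max[OF orthonormal_rotate_rows[OF u kl cs]] unfolding vk vl by linarith
      moreover have "c\<^sup>2 = 1 - s\<^sup>2" using cs by simp
      ultimately have "w * (\<gamma> - \<alpha>) * s\<^sup>2 + 2 * w * \<beta> * (c * s) \<le> 0"
        by (simp add: w_def algebra_simps)
      then have "(w * (\<gamma> - \<alpha>) * s\<^sup>2 + 2 * w * \<beta> * (c * s)) * r\<^sup>2 \<le> 0"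
        by (rule mult_nonpos_nonneg) simp
      moreover have "(w * (\<gamma> - \<alpha>) * s\<^sup>2 + 2 * w * \<beta> * (c * s)) * r\<^sup>2 = w * (\<gamma> - \<alpha>) * t\<^sup>2 + 2 * w * \<beta> * t"
        using r(1) by (simp add: c_def s_def field_simps power2_eq_square)
      ultimately show ?thesis by simp
    qed
    from quadratic_nonpos_imp_linear_zero[OF this] show "bform p A (u k) (u l) = 0"
      using kl by (simp add: w_def \<beta>_def)
  qed
qed

section \<open>Exponential integrals of Gaussian vectors\<close>

abbreviation std_normal_vec :: "nat \<Rightarrow> (nat \<Rightarrow> real) measure" where
  "std_normal_vec p \<equiv> PiM {..<p} (\<lambda>_. std_normal_distribution)"

section \<open>One-dimensional Gaussian integrals\<close>

lemma nn_integral_normal_density: "0 < \<sigma> \<Longrightarrow> (\<integral>\<^sup>+x. ennreal (normal_density \<mu> \<sigma> x) \<partial>lborel) = 1"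
  by (subst nn_integral_eq_integral) (auto simp: normal_density_nonneg)

text \<open>Completing the square turns the integrand into a multiple of the normal density with
  mean \<open>y\<close>.\<close>

lemma std_normal_mgf:
  "(\<integral>\<^sup>+x. ennreal (exp (y * x)) \<partial>std_normal_distribution) = ennreal (exp (y\<^sup>2 / 2))"
proof -
  have "(\<integral>\<^sup>+x. ennreal (exp (y * x)) \<partial>std_normal_distribution)
      = (\<integral>\<^sup>+x. ennreal (exp (y\<^sup>2 / 2)) * ennreal (normal_density y 1 x) \<partial>lborel)"
    by (subst nn_integral_density)
       (auto intro!: nn_integral_cong simp: normal_density_nonneg normal_density_def field_simps
         power2_eq_square exp_add[symmetric] simp flip: ennreal_mult)
  also have "\<dots> = ennreal (exp (y\<^sup>2 / 2))"
    by (subst nn_integral_cmult) (auto simp: nn_integral_normal_density)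
  finally show ?thesis .
qed

text \<open>The integrand is \<sigma> times the centred normal density of variance
  \<open>1 / (1 - 2 * a)\<close>. Negative \<open>a\<close> is included; the lower tail of the
  quadratic form relies on it.\<close>

lemma std_normal_square_mgf:
  assumes "2 * a < 1"
  shows "(\<integral>\<^sup>+x. ennreal (exp (a * x\<^sup>2)) \<partial>std_normal_distribution) = ennreal (1 / sqrt (1 - 2 * a))"
proof -
  define \<sigma> where "\<sigma> = 1 / sqrt (1 - 2 * a)"
  have \<sigma>: "\<sigma> > 0" "\<sigma>\<^sup>2 = 1 / (1 - 2 * a)" "1 - 2 * a > 0"
    using assms by (auto simp: \<sigma>_def power_divide)
  have "exp (a * x\<^sup>2) * std_normal_density x = \<sigma> * normal_density 0 \<sigma> x" for x
  proof -
    have "a * x\<^sup>2 - x\<^sup>2 / 2 = - x\<^sup>2 / (2 * \<sigma>\<^sup>2)"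
      unfolding \<sigma>(2) using \<sigma>(3) by (simp add: field_simps)
    then have "exp (a * x\<^sup>2) * exp (- x\<^sup>2 / 2) = exp (- x\<^sup>2 / (2 * \<sigma>\<^sup>2))"
      by (simp flip: exp_add)
    then show ?thesis
      using \<sigma>(1) by (simp add: normal_density_def real_sqrt_mult field_simps)
  qed
  then have "(\<integral>\<^sup>+x. ennreal (exp (a * x\<^sup>2)) \<partial>std_normal_distribution)
      = (\<integral>\<^sup>+x. ennreal \<sigma> * ennreal (normal_density 0 \<sigma> x) \<partial>lborel)"
    using \<sigma>(1) by (subst nn_integral_density)
       (auto intro!: nn_integral_cong simp: normal_density_nonneg mult.commute simp flip: ennreal_mult)
  also have "\<dots> = ennreal \<sigma>"
    using \<sigma>(1) by (subst nn_integral_cmult) (auto simp: nn_integral_normal_density)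
  finally show ?thesis by (simp add: \<sigma>_def)
qed

lemma std_normal_char:
  "(CLINT x|std_normal_distribution. iexp (y * x)) = exp (- y\<^sup>2 / 2)"
  using fun_cong[OF char_std_normal_distribution, of y] by (simp add: char_def)

text \<open>Gaussianity recorded through the exponential moment and the characteristic function of
  every linear combination. Both are multiplicative over independent summands and need no separate
  treatment of degenerate variances. The exponential moment later serves positive exponents of
  \<open>|Z|^2\<close>, the characteristic function negative ones.\<close>

definition gaussian_transforms ::
  "'a measure \<Rightarrow> nat \<Rightarrow> (nat \<Rightarrow> 'a \<Rightarrow> real) \<Rightarrow> (nat \<Rightarrow> nat \<Rightarrow> real) \<Rightarrow> bool" where
  "gaussian_transforms M p Z C \<longleftrightarrow> (\<forall>j<p. Z j \<in> borel_measurable M) \<and>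
     (\<forall>w. has_bochner_integral M (\<lambda>\<omega>. exp (\<Sum>j<p. w j * Z j \<omega>)) (exp (bform p C w w / 2)) \<and>
          (CLINT \<omega>|M. iexp (\<Sum>j<p. w j * Z j \<omega>)) = exp (- bform p C w w / 2))"

text \<open>Variance zero is a point mass; otherwise dividing by the standard deviation reduces both
  integrals to the standard normal law.\<close>

lemma (in prob_space) normal_exp_integrals:
  assumes [measurable]: "X \<in> borel_measurable M" and v: "v \<ge> 0"
    and X: "if v = 0 then AE \<omega> in M. X \<omega> = 0 
      else distributed M lborel X (\<lambda>x. ennreal (normal_density 0 (sqrt v) x))"
  shows "has_bochner_integral M (\<lambda>\<omega>. exp (X \<omega>)) (exp (v / 2))"
    and "(CLINT \<omega>|M. iexp (X \<omega>)) = exp (- v / 2)"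
proof -
  have "has_bochner_integral M (\<lambda>\<omega>. exp (X \<omega>)) (exp (v / 2)) \<and>
     (CLINT \<omega>|M. iexp (X \<omega>)) = exp (- v / 2)"
  proof (cases "v = 0")
    case True
    then have AE: "AE \<omega> in M. X \<omega> = 0" using X by simp
    have "has_bochner_integral M (\<lambda>\<omega>. exp (X \<omega>)) 1 = has_bochner_integral M (\<lambda>\<omega>. 1::real) 1"
      by (rule has_bochner_integral_cong_AE) (use AE in auto)
    moreover have "has_bochner_integral M (\<lambda>\<omega>. 1::real) 1"
      by (simp add: has_bochner_integral_iff prob_space)
    moreover have "(CLINT \<omega>|M. iexp (X \<omega>)) = (CLINT \<omega>|M. 1)"
      by (rule integral_cong_AE) (use AE in auto)
    ultimately show ?thesis using True by (simp add: prob_space)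
  next
    case False
    define \<sigma> where "\<sigma> = sqrt v"
    have \<sigma>: "\<sigma> > 0" "\<sigma>\<^sup>2 = v" using v False by (auto simp: \<sigma>_def)
    define Y where "Y \<omega> = X \<omega> / \<sigma>" for \<omega>
    have Xe: "X = (\<lambda>\<omega>. \<sigma> * Y \<omega>)" using \<sigma> by (auto simp: Y_def)
    have [measurable]: "Y \<in> borel_measurable M" by (simp add: Y_def[abs_def])
    have "distributed M lborel Y std_normal_density"
      using X normal_standard_normal_convert[OF \<sigma>(1), of X 0] False by (simp add: \<sigma>_def Y_def[abs_def])
    then have D: "distr M lborel Y = std_normal_distribution"
      by (rule distributed_distr_eq_density)
    have "(\<integral>\<^sup>+\<omega>. ennreal (exp (X \<omega>)) \<partial>M) = (\<integral>\<^sup>+x. ennreal (exp (\<sigma> * x)) \<partial>distr M lborel Y)"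
      by (subst nn_integral_distr) (auto simp: Xe)
    also have "\<dots> = ennreal (exp (v / 2))"
      unfolding D std_normal_mgf \<sigma>(2) ..
    finally have 1: "has_bochner_integral M (\<lambda>\<omega>. exp (X \<omega>)) (exp (v / 2))"
      by (intro has_bochner_integral_nn_integral) auto
    have "(CLINT \<omega>|M. iexp (X \<omega>)) = (CLINT x|distr M lborel Y. iexp (\<sigma> * x))"
      by (subst integral_distr) (auto simp: Xe)
    also have "\<dots> = exp (- v / 2)"
      unfolding D std_normal_char \<sigma>(2) ..
    finally show ?thesis using 1 by simp
  qed
  then show "has_bochner_integral M (\<lambda>\<omega>. exp (X \<omega>)) (exp (v / 2))"
    and "(CLINT \<omega>|M. iexp (X \<omega>)) = exp (- v / 2)" by auto
qed

lemma (in prob_space) gaussian_vec_transforms: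
  assumes "gaussian_vec M p X Sig" "sym_psd p Sig"
  shows "gaussian_transforms M p X Sig"
  unfolding gaussian_transforms_def
proof (intro conjI allI impI)
  have *: "\<forall>j<p. X j \<in> borel_measurable M"
    using assms(1) by (simp add: gaussian_vec_def)
  then show "j < p \<Longrightarrow> X j \<in> borel_measurable M" for j by blast
  fix w
  have m: "(\<lambda>\<omega>. \<Sum>j<p. w j * X j \<omega>) \<in> borel_measurable M"
    using * by (intro borel_measurable_sum borel_measurable_times) auto
  have "if bform p Sig w w = 0 then AE \<omega> in M. (\<Sum>j<p. w j * X j \<omega>) = 0
      else distributed M lborel (\<lambda>\<omega>. \<Sum>j<p. w j * X j \<omega>)
        (\<lambda>x. ennreal (normal_density 0 (sqrt (bform p Sig w w)) x))"
    using assms(1) by (simp add: gaussian_vec_def bform_def Let_def)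
  moreover have "bform p Sig w w \<ge> 0"
    using assms(2) by (simp add: sym_psd_def bform_def)
  ultimately show "has_bochner_integral M (\<lambda>\<omega>. exp (\<Sum>j<p. w j * X j \<omega>)) (exp (bform p Sig w w / 2))"
    "(CLINT \<omega>|M. iexp (\<Sum>j<p. w j * X j \<omega>)) = exp (- bform p Sig w w / 2)"
    using normal_exp_integrals[OF m] by blast+
qed

text \<open>Pairing \<open>w\<close> with \<open>X - Q Y\<close> gives \<open>U + V\<close>, where
  \<open>U\<close> pairs \<open>w\<close> with \<open>X\<close> and \<open>V\<close> pairs
  \<open>w' = - Q^T w\<close> with \<open>Y\<close>. Independence makes both transforms factor, so
  the exponents add; the sign of \<open>w'\<close> disappears in the quadratic form.\<close>

lemma (in prob_space) gaussian_transforms_diff: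
  assumes X: "gaussian_transforms M p X A" and Y: "gaussian_transforms M p Y B"
    and ind: "indep_var (PiM {..<p} (\<lambda>_. borel)) (\<lambda>\<omega>. restrict (\<lambda>j. X j \<omega>) {..<p})
      (PiM {..<p} (\<lambda>_. borel)) (\<lambda>\<omega>. restrict (\<lambda>j. Y j \<omega>) {..<p})"
    and C: "\<And>w. bform p C w w = bform p A w w + bform p B (\<lambda>b. \<Sum>a<p. w a * Q a b) (\<lambda>b. \<Sum>a<p. w a * Q a b)"
  shows "gaussian_transforms M p (\<lambda>a \<omega>. X a \<omega> - mvmult p Q (\<lambda>b. Y b \<omega>) a) C"
  unfolding gaussian_transforms_def
proof (intro conjI allI impI)
  have [measurable]: "j < p \<Longrightarrow> X j \<in> borel_measurable M" "j < p \<Longrightarrow> Y j \<in> borel_measurable M" for j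
    using X Y by (auto simp: gaussian_transforms_def)
  show "(\<lambda>\<omega>. X j \<omega> - mvmult p Q (\<lambda>b. Y b \<omega>) j) \<in> borel_measurable M" if [measurable]: "j < p" for j
    unfolding mvmult_def by (intro borel_measurable_diff borel_measurable_sum borel_measurable_times) auto
  fix w
  define w' where "w' b = - (\<Sum>a<p. w a * Q a b)" for b
  define U V where "U \<omega> = (\<Sum>j<p. w j * X j \<omega>)" and "V \<omega> = (\<Sum>j<p. w' j * Y j \<omega>)" for \<omega>
  have eq: "(\<Sum>j<p. w j * (X j \<omega> - mvmult p Q (\<lambda>b. Y b \<omega>) j)) = U \<omega> + V \<omega>" for \<omega>
  proof -
    have "(\<Sum>j<p. w j * mvmult p Q (\<lambda>b. Y b \<omega>) j) = (\<Sum>a<p. \<Sum>b<p. w a * Q a b * Y b \<omega>)"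
      by (simp add: mvmult_def sum_distrib_left mult.assoc)
    also have "\<dots> = - V \<omega>"
      by (subst sum.swap) (simp add: V_def w'_def sum_distrib_right flip: sum_negf)
    finally show ?thesis
      by (simp add: U_def right_diff_distrib sum_subtractf)
  qed
  have "bform p B w' w' = bform p B (\<lambda>b. \<Sum>a<p. w a * Q a b) (\<lambda>b. \<Sum>a<p. w a * Q a b)"
    by (simp add: w'_def[abs_def] bform_def)
  then have Cw: "bform p C w w = bform p A w w + bform p B w' w'" using C by simp
  have comb[measurable]: "(\<lambda>x. \<Sum>j<p. v j * x j) \<in> borel_measurable (PiM {..<p} (\<lambda>_. borel))" for v :: "nat \<Rightarrow> real"
    by measurable
  have UV: "indep_var borel U borel V"
  proof -
    have "indep_var borel ((\<lambda>x. \<Sum>j<p. w j * x j) \<circ> (\<lambda>\<omega>. restrict (\<lambda>j. X j \<omega>) {..<p}))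
        borel ((\<lambda>x. \<Sum>j<p. w' j * x j) \<circ> (\<lambda>\<omega>. restrict (\<lambda>j. Y j \<omega>) {..<p}))"
      by (rule indep_var_compose[OF ind comb comb])
    then show ?thesis by (simp add: U_def[abs_def] V_def[abs_def] comp_def)
  qed
  then have [measurable]: "U \<in> borel_measurable M" "V \<in> borel_measurable M"
    using indep_var_rv1 indep_var_rv2 by blast+
  have U: "has_bochner_integral M (\<lambda>\<omega>. exp (U \<omega>)) (exp (bform p A w w / 2))"
      "(CLINT \<omega>|M. iexp (U \<omega>)) = exp (- bform p A w w / 2)"
    using X by (simp_all add: gaussian_transforms_def U_def)
  have V: "has_bochner_integral M (\<lambda>\<omega>. exp (V \<omega>)) (exp (bform p B w' w' / 2))"
      "(CLINT \<omega>|M. iexp (V \<omega>)) = exp (- bform p B w' w' / 2)"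
    using Y by (simp_all add: gaussian_transforms_def V_def)
  have ie: "indep_var borel (\<lambda>\<omega>. exp (U \<omega>)) borel (\<lambda>\<omega>. exp (V \<omega>))"
    using indep_var_compose[OF UV, of exp borel exp borel] by (simp add: comp_def)
  have ii: "indep_var borel (\<lambda>\<omega>. iexp (U \<omega>)) borel (\<lambda>\<omega>. iexp (V \<omega>))"
    using indep_var_compose[OF UV, of "\<lambda>x. iexp x" borel "\<lambda>x. iexp x" borel] by (simp add: comp_def)
  show "has_bochner_integral M (\<lambda>\<omega>. exp (\<Sum>j<p. w j * (X j \<omega> - mvmult p Q (\<lambda>b. Y b \<omega>) j)))
      (exp (bform p C w w / 2))"
    using indep_var_integrable[OF ie] indep_var_lebesgue_integral[OF ie] U(1) V(1)
    by (simp add: eq exp_add has_bochner_integral_iff Cw add_divide_distrib)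
  have int: "integrable M (\<lambda>\<omega>. iexp (U \<omega>))" "integrable M (\<lambda>\<omega>. iexp (V \<omega>))"
    by (auto intro!: integrable_iexp)
  have "(CLINT \<omega>|M. iexp (U \<omega> + V \<omega>)) = (CLINT \<omega>|M. iexp (U \<omega>) * iexp (V \<omega>))"
    by (simp add: distrib_left exp_add)
  also have "\<dots> = exp (- bform p A w w / 2) * exp (- bform p B w' w' / 2)"
    using indep_var_lebesgue_integral[OF ii int] U(2) V(2) by simp
  also have "\<dots> = exp (- bform p C w w / 2)"
    unfolding Cw by (simp add: add_divide_distrib diff_divide_distrib flip: exp_add exp_of_real)
  finally show "(CLINT \<omega>|M. iexp (\<Sum>j<p. w j * (X j \<omega> - mvmult p Q (\<lambda>b. Y b \<omega>) j))) = exp (- bform p C w w / 2)"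
    unfolding eq .
qed

section \<open>Sums and forms in an orthonormal eigenbasis\<close>

lemma orthonormal_parseval:
  assumes u: "orthonormal p u"
  shows "(\<Sum>k<p. (\<Sum>a<p. u k a * x a) * (\<Sum>a<p. u k a * y a)) = (\<Sum>a<p. x a * y a)"
proof -
  have "(\<Sum>k<p. (\<Sum>a<p. u k a * x a) * (\<Sum>a<p. u k a * y a))
      = (\<Sum>k<p. \<Sum>a<p. \<Sum>b<p. x a * y b * (u k a * u k b))"
    by (simp add: sum_product algebra_simps)
  also have "\<dots> = (\<Sum>a<p. \<Sum>b<p. x a * y b * (\<Sum>k<p. u k a * u k b))"
    unfolding sum_distrib_left
    by (subst sum.swap, rule sum.cong[OF refl], subst sum.swap, rule refl)
  also have "\<dots> = (\<Sum>a<p. \<Sum>b<p. x a * y b * (if a = b then 1 else 0))"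
    using orthonormal_column[OF u] by (intro sum.cong refl) auto
  also have "\<dots> = (\<Sum>a<p. x a * y a)"
    by (simp add: if_distrib cong: if_cong)
  finally show ?thesis .
qed

lemma bform_diagonal:
  assumes "\<And>k l. k < p \<Longrightarrow> l < p \<Longrightarrow> k \<noteq> l \<Longrightarrow> bform p C (u k) (u l) = 0"
  shows "bform p C (\<lambda>a. \<Sum>k<p. g k * u k a) (\<lambda>a. \<Sum>k<p. g k * u k a)
    = (\<Sum>k<p. (g k)\<^sup>2 * bform p C (u k) (u k))"
proof -
  have "bform p C (\<lambda>a. \<Sum>k<p. g k * u k a) (\<lambda>a. \<Sum>k<p. g k * u k a)
      = (\<Sum>k<p. \<Sum>l<p. if k = l then (g k)\<^sup>2 * bform p C (u k) (u k) else 0)"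
    unfolding bform_sum_left bform_sum_right bform_scale_left bform_scale_right
    using assms by (intro sum.cong refl) (auto simp: power2_eq_square)
  then show ?thesis by simp
qed

text \<open>Stated over a general field so that the same exchange of sums serves both a real
  coefficient \<open>r\<close> and the purely imaginary one in \<open>iexp\<close>.\<close>

lemma prod_exp_linear:
  fixes r :: "'b::{real_normed_field,banach}" and p :: nat
  shows "(\<Prod>k<p. exp (r * of_real (g k) * of_real (\<Sum>a<p. u k a * z a))) =
    exp (r * of_real (\<Sum>a<p. (\<Sum>k<p. g k * u k a) * z a))"
proof -
  have "(\<Sum>k<p. g k * (\<Sum>a<p. u k a * z a)) = (\<Sum>a<p. (\<Sum>k<p. g k * u k a) * z a)"
    unfolding sum_distrib_left sum_distrib_right mult.assoc by (rule sum.swap)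
  moreover have "(\<Prod>k<p. exp (r * of_real (g k) * of_real (\<Sum>a<p. u k a * z a)))
      = exp (\<Sum>k<p. r * of_real (g k * (\<Sum>a<p. u k a * z a)))"
    unfolding of_real_mult mult.assoc by (rule exp_sum[symmetric]) simp
  moreover have "(\<Sum>k<p. r * of_real (g k * (\<Sum>a<p. u k a * z a)))
      = r * of_real (\<Sum>k<p. g k * (\<Sum>a<p. u k a * z a))"
    unfolding of_real_sum by (rule sum_distrib_left[symmetric])
  ultimately show ?thesis by simp
qed

section \<open>Laplace transform of the squared norm of a Gaussian vector\<close>

context prob_space
begin

context
  fixes p :: nat and Z :: "nat \<Rightarrow> 'a \<Rightarrow> real" and C u :: "nat \<Rightarrow> nat \<Rightarrow> real" and c :: "nat \<Rightarrow> real"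
  assumes Z: "gaussian_transforms M p Z C"
    and u: "orthonormal p u"
    and diag: "\<And>k l. k < p \<Longrightarrow> l < p \<Longrightarrow> k \<noteq> l \<Longrightarrow> bform p C (u k) (u l) = 0"
    and c: "\<And>k. c k = bform p C (u k) (u k)"
begin

lemma transforms_measurable: "j < p \<Longrightarrow> Z j \<in> borel_measurable M"
  using Z by (simp add: gaussian_transforms_def)

lemma prob_space_std_normal_vec: "prob_space (std_normal_vec p)"
  by (intro prob_space_PiM prob_space_normal_density) simp

lemma coordinate_measurable: "k < p \<Longrightarrow> (\<lambda>g. g k) \<in> borel_measurable (std_normal_vec p)"
  using measurable_component_singleton[of k "{..<p}" "\<lambda>_. std_normal_distribution"] by simp

text \<open>Linearisation: \<open>exp (\<theta> |Z|\<^sup>2)\<close> is the average of \<open>exp (\<surd>(2\<theta>) \<Sum>k. g\<^sub>k (u\<^sub>k \<bullet> Z))\<close> over an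
  independent standard Gaussian \<open>g\<close>; averaging over \<open>Z\<close> first leaves a product of
  one-dimensional integrals.\<close>

lemma gaussian_square_norm_mgf:
  assumes \<theta>: "\<theta> \<ge> 0" and small: "\<And>k. k < p \<Longrightarrow> 2 * \<theta> * c k < 1"
  shows "(\<integral>\<^sup>+\<omega>. ennreal (exp (\<theta> * (\<Sum>a<p. (Z a \<omega>)\<^sup>2))) \<partial>M)
    = ennreal (\<Prod>k<p. 1 / sqrt (1 - 2 * \<theta> * c k))"
proof -
  \<comment> \<open>With this \<open>r\<close> the standard normal average of
    \<open>exp (r * y * x)\<close> over \<open>x\<close> is
    \<open>exp (\<theta> * y\<^sup>2)\<close>.\<close>
  define r where "r = sqrt (2 * \<theta>)"
  have r: "r\<^sup>2 = 2 * \<theta>" using \<theta> by (simp add: r_def)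
  have sq: "(r * y)\<^sup>2 / 2 = \<theta> * y\<^sup>2" for y by (simp add: power_mult_distrib r)
  interpret G: prob_space "std_normal_vec p" by (rule prob_space_std_normal_vec)
  interpret P: product_sigma_finite "\<lambda>_::nat. std_normal_distribution"
    by (intro product_sigma_finite.intro prob_space_imp_sigma_finite prob_space_normal_density) simp
  interpret MG: pair_sigma_finite M "std_normal_vec p" ..
  note [measurable] = transforms_measurable coordinate_measurable
  have "ennreal (exp (\<theta> * (\<Sum>a<p. (Z a \<omega>)\<^sup>2)))
      = (\<integral>\<^sup>+g. ennreal (exp (r * (\<Sum>a<p. (\<Sum>k<p. g k * u k a) * Z a \<omega>))) \<partial>std_normal_vec p)" for \<omega>
  proof -
    let ?y = "\<lambda>k. \<Sum>a<p. u k a * Z a \<omega>"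
    have "(\<Sum>a<p. (Z a \<omega>)\<^sup>2) = (\<Sum>k<p. (?y k)\<^sup>2)"
      using orthonormal_parseval[OF u, of "\<lambda>a. Z a \<omega>" "\<lambda>a. Z a \<omega>"] by (simp add: power2_eq_square)
    then have "exp (\<theta> * (\<Sum>a<p. (Z a \<omega>)\<^sup>2)) = (\<Prod>k<p. exp ((r * ?y k)\<^sup>2 / 2))"
      by (simp only: sq sum_distrib_left[of _ "\<lambda>k. (?y k)\<^sup>2"] exp_sum finite_lessThan)
    then have "ennreal (exp (\<theta> * (\<Sum>a<p. (Z a \<omega>)\<^sup>2)))
        = (\<Prod>k<p. \<integral>\<^sup>+x. ennreal (exp (r * ?y k * x)) \<partial>std_normal_distribution)"
      by (simp only: std_normal_mgf) (simp add: prod_ennreal)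
    also have "\<dots> = (\<integral>\<^sup>+g. (\<Prod>k<p. ennreal (exp (r * ?y k * g k))) \<partial>std_normal_vec p)"
      by (rule P.product_nn_integral_prod[symmetric]) auto
    also have "\<dots> = (\<integral>\<^sup>+g. ennreal (exp (r * (\<Sum>a<p. (\<Sum>k<p. g k * u k a) * Z a \<omega>))) \<partial>std_normal_vec p)"
      using prod_exp_linear[of r _ u "\<lambda>a. Z a \<omega>"] by (simp add: prod_ennreal mult_ac)
    finally show ?thesis .
  qed
  then have "(\<integral>\<^sup>+\<omega>. ennreal (exp (\<theta> * (\<Sum>a<p. (Z a \<omega>)\<^sup>2))) \<partial>M)
     = (\<integral>\<^sup>+\<omega>. (\<integral>\<^sup>+g. ennreal (exp (r * (\<Sum>a<p. (\<Sum>k<p. g k * u k a) * Z a \<omega>))) \<partial>std_normal_vec p) \<partial>M)"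
    by simp
  \<comment> \<open>Tonelli: the integrand is nonnegative, so the order may be exchanged before
    anything is known to be finite.\<close>
  also have "\<dots> = (\<integral>\<^sup>+g. (\<integral>\<^sup>+\<omega>. ennreal (exp (r * (\<Sum>a<p. (\<Sum>k<p. g k * u k a) * Z a \<omega>))) \<partial>M) \<partial>std_normal_vec p)"
    by (rule MG.Fubini'[symmetric]) (simp add: split_beta')
  also have "\<dots> = (\<integral>\<^sup>+g. (\<Prod>k<p. ennreal (exp (\<theta> * c k * (g k)\<^sup>2))) \<partial>std_normal_vec p)"
  proof (rule nn_integral_cong)
    fix g
    \<comment> \<open>For fixed \<open>g\<close> the exponent is a linear form in \<open>Z\<close>.
      Since \<open>u\<close> diagonalises \<open>C\<close>, its variance is a sum over
      \<open>k\<close>, and the inner integral splits into factors depending on one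
      \<open>g k\<close> each.\<close>
    define w where "w a = r * (\<Sum>k<p. g k * u k a)" for a
    have "bform p C (\<lambda>a. \<Sum>k<p. g k * u k a) (\<lambda>a. \<Sum>k<p. g k * u k a) = (\<Sum>k<p. (g k)\<^sup>2 * c k)"
      unfolding c by (rule bform_diagonal) (rule diag)
    then have bw: "bform p C w w = r\<^sup>2 * (\<Sum>k<p. (g k)\<^sup>2 * c k)"
      unfolding w_def bform_scale_left bform_scale_right by (simp add: power2_eq_square)
    have wZ: "(\<Sum>j<p. w j * Z j \<omega>) = r * (\<Sum>a<p. (\<Sum>k<p. g k * u k a) * Z a \<omega>)" for \<omega>
      unfolding w_def mult.assoc by (rule sum_distrib_left[symmetric])
    have "bform p C w w / 2 = (\<Sum>k<p. \<theta> * c k * (g k)\<^sup>2)"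
      unfolding bw r by (simp add: sum_distrib_left mult_ac)
    moreover have "has_bochner_integral M (\<lambda>\<omega>. exp (\<Sum>j<p. w j * Z j \<omega>)) (exp (bform p C w w / 2))"
      using Z by (simp add: gaussian_transforms_def)
    ultimately have "(\<integral>\<^sup>+\<omega>. ennreal (exp (\<Sum>j<p. w j * Z j \<omega>)) \<partial>M) = ennreal (\<Prod>k<p. exp (\<theta> * c k * (g k)\<^sup>2))"
      by (subst nn_integral_eq_integral) (auto simp: has_bochner_integral_iff exp_sum prod_nonneg)
    then show "(\<integral>\<^sup>+\<omega>. ennreal (exp (r * (\<Sum>a<p. (\<Sum>k<p. g k * u k a) * Z a \<omega>))) \<partial>M)
        = (\<Prod>k<p. ennreal (exp (\<theta> * c k * (g k)\<^sup>2)))"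
      by (simp only: wZ) (simp add: prod_ennreal)
  qed
  also have "\<dots> = (\<Prod>k<p. \<integral>\<^sup>+x. ennreal (exp (\<theta> * c k * x\<^sup>2)) \<partial>std_normal_distribution)"
    by (rule P.product_nn_integral_prod) auto
  also have "\<dots> = (\<Prod>k<p. ennreal (1 / sqrt (1 - 2 * \<theta> * c k)))"
    using small by (intro prod.cong refl) (subst std_normal_square_mgf, auto simp: mult.assoc)
  also have "\<dots> = ennreal (\<Prod>k<p. 1 / sqrt (1 - 2 * \<theta> * c k))"
    using small by (intro prod_ennreal) (simp add: less_imp_le)
  finally show ?thesis .
qed

text \<open>The same linearisation for a negative exponent:
  \<open>exp (- \<theta> * y\<^sup>2)\<close> is the standard normal characteristic function at
  \<open>r * y\<close>, so the coefficient becomes imaginary. The integrand then has modulus 1 and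
  Fubini applies for every nonnegative \<theta>, with no smallness condition.\<close>

lemma gaussian_square_norm_laplace:
  assumes \<theta>: "\<theta> \<ge> 0" and c0: "\<And>k. k < p \<Longrightarrow> 0 \<le> c k"
  shows "(\<integral>\<^sup>+\<omega>. ennreal (exp (- \<theta> * (\<Sum>a<p. (Z a \<omega>)\<^sup>2))) \<partial>M)
    = ennreal (\<Prod>k<p. 1 / sqrt (1 + 2 * \<theta> * c k))"
proof -
  define r where "r = sqrt (2 * \<theta>)"
  have r: "r\<^sup>2 = 2 * \<theta>" using \<theta> by (simp add: r_def)
  have sq: "- (r * y)\<^sup>2 / 2 = - \<theta> * y\<^sup>2" for y by (simp add: power_mult_distrib r)
  interpret G: prob_space "std_normal_vec p" by (rule prob_space_std_normal_vec)
  interpret N: prob_space std_normal_distribution by (rule prob_space_normal_density) simp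
  interpret P: product_sigma_finite "\<lambda>_::nat. std_normal_distribution"
    by (intro product_sigma_finite.intro N.sigma_finite_measure_axioms)
  interpret MG: pair_prob_space "std_normal_vec p" M ..
  note [measurable] = transforms_measurable coordinate_measurable
  let ?e = "\<lambda>\<omega> g. iexp (r * (\<Sum>a<p. (\<Sum>k<p. g k * u k a) * Z a \<omega>))"
  have L: "complex_of_real (exp (- \<theta> * (\<Sum>a<p. (Z a \<omega>)\<^sup>2))) = (CLINT g|std_normal_vec p. ?e \<omega> g)" for \<omega>
  proof -
    let ?y = "\<lambda>k. \<Sum>a<p. u k a * Z a \<omega>"
    have "(\<Sum>a<p. (Z a \<omega>)\<^sup>2) = (\<Sum>k<p. (?y k)\<^sup>2)"
      using orthonormal_parseval[OF u, of "\<lambda>a. Z a \<omega>" "\<lambda>a. Z a \<omega>"] by (simp add: power2_eq_square)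
    then have "exp (- \<theta> * (\<Sum>a<p. (Z a \<omega>)\<^sup>2)) = (\<Prod>k<p. exp (- (r * ?y k)\<^sup>2 / 2))"
      by (simp only: sq sum_distrib_left[of _ "\<lambda>k. (?y k)\<^sup>2"] exp_sum finite_lessThan)
    then have "complex_of_real (exp (- \<theta> * (\<Sum>a<p. (Z a \<omega>)\<^sup>2)))
        = (\<Prod>k<p. CLINT x|std_normal_distribution. iexp (r * ?y k * x))"
      by (simp only: std_normal_char of_real_prod)
    also have "\<dots> = (CLINT g|std_normal_vec p. (\<Prod>k<p. iexp (r * ?y k * g k)))"
      by (rule P.product_integral_prod[symmetric]) (auto intro!: N.integrable_iexp)
    also have "\<dots> = (CLINT g|std_normal_vec p. ?e \<omega> g)"
      using prod_exp_linear[of "\<i> * complex_of_real r" _ u "\<lambda>a. Z a \<omega>"] by (simp add: mult_ac)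
    finally show ?thesis .
  qed
  have "(CLINT \<omega>|M. complex_of_real (exp (- \<theta> * (\<Sum>a<p. (Z a \<omega>)\<^sup>2))))
      = (CLINT \<omega>|M. (CLINT g|std_normal_vec p. ?e \<omega> g))"
    by (simp only: L)
  also have "\<dots> = (CLINT g|std_normal_vec p. (CLINT \<omega>|M. ?e \<omega> g))"
    by (rule MG.Fubini_integral)
      (auto intro!: MG.integrable_const_bound[where B = 1] simp: split_beta')
  also have "\<dots> = (CLINT g|std_normal_vec p. (\<Prod>k<p. complex_of_real (exp (- \<theta> * c k * (g k)\<^sup>2))))"
  proof (rule Bochner_Integration.integral_cong[OF refl])
    fix g
    define w where "w a = r * (\<Sum>k<p. g k * u k a)" for a
    have "bform p C (\<lambda>a. \<Sum>k<p. g k * u k a) (\<lambda>a. \<Sum>k<p. g k * u k a) = (\<Sum>k<p. (g k)\<^sup>2 * c k)"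
      unfolding c by (rule bform_diagonal) (rule diag)
    then have bw: "bform p C w w = r\<^sup>2 * (\<Sum>k<p. (g k)\<^sup>2 * c k)"
      unfolding w_def bform_scale_left bform_scale_right by (simp add: power2_eq_square)
    have wZ: "(\<Sum>j<p. w j * Z j \<omega>) = r * (\<Sum>a<p. (\<Sum>k<p. g k * u k a) * Z a \<omega>)" for \<omega>
      unfolding w_def mult.assoc by (rule sum_distrib_left[symmetric])
    have w: "- bform p C w w / 2 = (\<Sum>k<p. - \<theta> * c k * (g k)\<^sup>2)"
      unfolding bw r by (simp add: sum_distrib_left sum_negf mult_ac)
    have "(CLINT \<omega>|M. iexp (\<Sum>j<p. w j * Z j \<omega>)) = exp (- bform p C w w / 2)"
      using Z by (simp add: gaussian_transforms_def)
    then have "(CLINT \<omega>|M. iexp (\<Sum>j<p. w j * Z j \<omega>)) = complex_of_real (\<Prod>k<p. exp (- \<theta> * c k * (g k)\<^sup>2))"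
      unfolding w by (simp only: exp_sum finite_lessThan)
    then show "(CLINT \<omega>|M. ?e \<omega> g) = (\<Prod>k<p. complex_of_real (exp (- \<theta> * c k * (g k)\<^sup>2)))"
      by (simp only: wZ of_real_prod)
  qed
  \<comment> \<open>Nonnegative eigenvalues bound every factor by 1, which supplies the
    integrability behind the product formula.\<close>
  also have "\<dots> = (\<Prod>k<p. CLINT x|std_normal_distribution. complex_of_real (exp (- \<theta> * c k * x\<^sup>2)))"
    using \<theta> c0 by (intro P.product_integral_prod)
      (auto intro!: N.integrable_const_bound[where B = 1] AE_I2)
  also have "\<dots> = (\<Prod>k<p. complex_of_real (1 / sqrt (1 + 2 * \<theta> * c k)))"
  proof (intro prod.cong refl)
    fix k assume "k \<in> {..<p}"
    then have k: "\<theta> * c k \<ge> 0" using \<theta> c0 by simp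
    have "(\<integral>x. exp (- \<theta> * c k * x\<^sup>2) \<partial>std_normal_distribution) = 1 / sqrt (1 - 2 * (- \<theta> * c k))"
      using std_normal_square_mgf[of "- \<theta> * c k"] k by (subst integral_eq_nn_integral) (auto simp: )
    then show "(CLINT x|std_normal_distribution. complex_of_real (exp (- \<theta> * c k * x\<^sup>2)))
        = complex_of_real (1 / sqrt (1 + 2 * \<theta> * c k))"
      by (simp only: integral_complex_of_real) (simp add: mult.assoc)
  qed
  finally have "complex_of_real (\<integral>\<omega>. exp (- \<theta> * (\<Sum>a<p. (Z a \<omega>)\<^sup>2)) \<partial>M)
      = complex_of_real (\<Prod>k<p. 1 / sqrt (1 + 2 * \<theta> * c k))"
    by (simp only: integral_complex_of_real of_real_prod)
  then have "(\<integral>\<omega>. exp (- \<theta> * (\<Sum>a<p. (Z a \<omega>)\<^sup>2)) \<partial>M) = (\<Prod>k<p. 1 / sqrt (1 + 2 * \<theta> * c k))"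
    by (simp only: of_real_eq_iff)
  moreover have "integrable M (\<lambda>\<omega>. exp (- \<theta> * (\<Sum>a<p. (Z a \<omega>)\<^sup>2)))"
    using \<theta> by (intro integrable_const_bound[where B = 1] AE_I2) (auto intro!: mult_nonneg_nonneg sum_nonneg)
  ultimately show ?thesis
    by (subst nn_integral_eq_integral) auto
qed

end

end

section \<open>Tail bounds\<close>

text \<open>Second-order expansion of the logarithm. At \<open>x = 2 * t * c k\<close> the exponent
  becomes \<open>t * c k + 4 * t\<^sup>2 * (c k)\<^sup>2\<close>: the first term will cancel against
  the trace, the second is the source of the factor 4 in the exponential moment bounds.\<close>

lemma inverse_sqrt_le_exp:
  assumes "\<bar>x\<bar> \<le> 1 / 2"
  shows "1 / sqrt (1 - x) \<le> exp (x / 2 + x\<^sup>2)"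
proof -
  have pos: "1 - x > 0" using assms by linarith
  have "- ln (1 - x) \<le> x + 2 * x\<^sup>2"
    using abs_ln_one_plus_x_minus_x_bound[of "- x"] assms by simp
  then have "- ln (1 - x) / 2 \<le> x / 2 + x\<^sup>2" by simp
  then have "exp (- ln (1 - x) / 2) \<le> exp (x / 2 + x\<^sup>2)" by simp
  moreover have "1 / sqrt (1 - x) = exp (- ln (1 - x) / 2)"
    using pos by (simp add: ln_sqrt[symmetric] exp_minus inverse_eq_divide)
  ultimately show ?thesis by simp
qed

context prob_space
begin

text \<open>For \<open>F + 4 \<surd>L c > 0\<close> take \<open>\<theta> = \<surd>L / (F + 4 \<surd>L c)\<close> in Markov's inequality for
  \<open>exp (\<theta> X)\<close>; if \<open>F = c = 0\<close>, let \<open>\<theta> \<rightarrow> \<infinity>\<close>.\<close>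

lemma subexponential_tail:
  assumes [measurable]: "X \<in> borel_measurable M" and L: "L > 0" and F: "F \<ge> 0" and c: "c \<ge> 0"
    and mgf: "\<And>\<theta>. 0 \<le> \<theta> \<Longrightarrow> 4 * \<theta> * c \<le> 1 \<Longrightarrow>
      (\<integral>\<^sup>+\<omega>. ennreal (exp (\<theta> * X \<omega>)) \<partial>M) \<le> ennreal (exp (4 * \<theta>\<^sup>2 * F\<^sup>2))"
  shows "prob {\<omega> \<in> space M. X \<omega> > 48 * (sqrt L * F + L * c)} \<le> exp (- 8 * L)"
proof -
  \<comment> \<open>Markov's inequality: the indicator of \<open>X >= s\<close> is dominated by
    \<open>exp (\<theta> * (X - s))\<close>.\<close>
  have chernoff: "prob {\<omega> \<in> space M. X \<omega> \<ge> s} \<le> exp (4 * \<theta>\<^sup>2 * F\<^sup>2 - \<theta> * s)"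
    if \<theta>: "0 \<le> \<theta>" "4 * \<theta> * c \<le> 1" for \<theta> s
  proof -
    have "ennreal (prob {\<omega> \<in> space M. X \<omega> \<ge> s}) = (\<integral>\<^sup>+\<omega>. indicator {\<omega> \<in> space M. X \<omega> \<ge> s} \<omega> \<partial>M)"
      by (simp add: emeasure_eq_measure)
    also have "\<dots> \<le> (\<integral>\<^sup>+\<omega>. ennreal (exp (- \<theta> * s)) * ennreal (exp (\<theta> * X \<omega>)) \<partial>M)"
    proof (rule nn_integral_mono)
      fix \<omega>
      have "1 \<le> exp (- \<theta> * s + \<theta> * X \<omega>)" if "X \<omega> \<ge> s"
        using mult_left_mono[OF that \<theta>(1)] by simp
      then show "indicator {\<omega> \<in> space M. X \<omega> \<ge> s} \<omega> \<le> ennreal (exp (- \<theta> * s)) * ennreal (exp (\<theta> * X \<omega>))"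
        by (auto simp: indicator_def simp flip: ennreal_mult exp_add)
    qed
    also have "\<dots> = ennreal (exp (- \<theta> * s)) * (\<integral>\<^sup>+\<omega>. ennreal (exp (\<theta> * X \<omega>)) \<partial>M)"
      by (rule nn_integral_cmult) simp
    also have "\<dots> \<le> ennreal (exp (- \<theta> * s)) * ennreal (exp (4 * \<theta>\<^sup>2 * F\<^sup>2))"
      by (intro mult_left_mono mgf \<theta>) simp
    also have "\<dots> = ennreal (exp (4 * \<theta>\<^sup>2 * F\<^sup>2 - \<theta> * s))"
      by (simp add: algebra_simps flip: ennreal_mult exp_add)
    finally show ?thesis by simp
  qed
  define s where "s = 48 * (sqrt L * F + L * c)"
  show ?thesis
  proof (cases "F = 0 \<and> c = 0")
    case True
    have null: "prob {\<omega> \<in> space M. X \<omega> \<ge> 1 / real (Suc n)} = 0" for n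
    proof -
      have "((\<lambda>\<theta>. exp (- \<theta> / real (Suc n))) \<longlongrightarrow> 0) at_top"
        by real_asymp
      moreover have "eventually (\<lambda>\<theta>. prob {\<omega> \<in> space M. X \<omega> \<ge> 1 / real (Suc n)} \<le> exp (- \<theta> / real (Suc n))) at_top"
        using eventually_ge_at_top[of 0]
        by eventually_elim (use chernoff[of _ "1 / real (Suc n)"] True in auto)
      ultimately have "prob {\<omega> \<in> space M. X \<omega> \<ge> 1 / real (Suc n)} \<le> 0"
        by (intro tendsto_lowerbound) auto
      then show ?thesis by (simp add: measure_le_0_iff)
    qed
    \<comment> \<open>In the degenerate case the claim is that \<open>X > 0\<close> has probability
      zero; this event is a countable union of the null events just found.\<close>
    have "AE \<omega> in M. \<forall>n. \<not> X \<omega> \<ge> 1 / real (Suc n)"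
      unfolding AE_all_countable
    proof
      fix n
      show "AE \<omega> in M. \<not> X \<omega> \<ge> 1 / real (Suc n)"
        by (rule AE_I[where N = "{\<omega> \<in> space M. X \<omega> \<ge> 1 / real (Suc n)}"])
          (use null[of n] in \<open>auto simp: emeasure_eq_measure\<close>)
    qed
    then have "AE \<omega> in M. \<not> X \<omega> > 0"
    proof eventually_elim
      case (elim \<omega>)
      show ?case
      proof
        assume "X \<omega> > 0"
        then obtain n where "inverse (real (Suc n)) < X \<omega>" using reals_Archimedean by blast
        with elim show False by (auto simp: inverse_eq_divide not_le dest!: spec[of _ n])
      qed
    qed
    then have "prob {\<omega> \<in> space M. X \<omega> > 0} = 0"
      by (subst prob_eq_0) auto
    then show ?thesis using True by simp
  next
    case False
    \<comment> \<open>This \<open>d\<close> ensures both \<open>\<theta> * F <= sqrt L\<close> and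
      \<open>4 * \<theta> * c <= 1\<close>. Since 48 = 12 * 4, the threshold \<open>s\<close> is at
      least \<open>12 * sqrt L * d\<close>, so \<open>\<theta> * s >= 12 * L\<close>; subtracting it
      from the variance term, at most \<open>4 * L\<close>, yields \<open>- 8 * L\<close>.\<close>
    define d where "d = F + 4 * sqrt L * c"
    have d: "d > 0" using False F c L
      by (cases "F = 0") (auto simp: d_def intro!: add_pos_nonneg mult_pos_pos)
    define \<theta> where "\<theta> = sqrt L / d"
    have \<theta>: "\<theta> \<ge> 0" "\<theta> * d = sqrt L" using d L by (auto simp: \<theta>_def)
    have sL: "sqrt L * sqrt L = L" "sqrt L > 0" using L by auto
    have tF: "\<theta> * F \<le> sqrt L"
      using \<theta> mult_left_mono[of F d \<theta>] c L by (simp add: d_def)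
    have "\<theta> * (4 * sqrt L * c) \<le> sqrt L"
      using \<theta> mult_left_mono[of "4 * sqrt L * c" d \<theta>] F by (simp add: d_def)
    then have "sqrt L * (4 * \<theta> * c) \<le> sqrt L * 1" by (simp add: mult_ac)
    then have tc: "4 * \<theta> * c \<le> 1" using sL(2) by (subst (asm) mult_le_cancel_left_pos) 
    have "(\<theta> * F)\<^sup>2 \<le> (sqrt L)\<^sup>2" using tF \<theta> F by (intro power_mono) auto
    then have q: "4 * \<theta>\<^sup>2 * F\<^sup>2 \<le> 4 * L" using L by (simp add: power_mult_distrib)
    have "s \<ge> 12 * sqrt L * d"
      using F L sL by (simp add: s_def d_def algebra_simps) (simp add: mult.assoc[symmetric])
    then have "\<theta> * s \<ge> \<theta> * (12 * sqrt L * d)" using \<theta>(1) by (rule mult_left_mono)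
    also have "\<theta> * (12 * sqrt L * d) = 12 * (sqrt L * (\<theta> * d))" by simp
    also have "\<dots> = 12 * L" unfolding \<theta>(2) sL(1) ..
    finally have "4 * \<theta>\<^sup>2 * F\<^sup>2 - \<theta> * s \<le> - 8 * L" using q by linarith
    then have "exp (4 * \<theta>\<^sup>2 * F\<^sup>2 - \<theta> * s) \<le> exp (- 8 * L)" by simp
    moreover have "prob {\<omega> \<in> space M. X \<omega> > s} \<le> prob {\<omega> \<in> space M. X \<omega> \<ge> s}"
      by (rule finite_measure_mono) auto
    ultimately show ?thesis
      using chernoff[OF \<theta>(1) tc, of s] unfolding s_def[symmetric] by linarith
  qed
qed

end

section \<open>Trace, Frobenius norm and maximal value of a quadratic form\<close>

lemma orthonormal_trace:
  assumes u: "orthonormal p u"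
  shows "(\<Sum>k<p. bform p C (u k) (u k)) = (\<Sum>a<p. C a a)"
proof -
  have "(\<Sum>k<p. bform p C (u k) (u k)) = (\<Sum>a<p. \<Sum>b<p. \<Sum>k<p. u k a * C a b * u k b)"
    unfolding bform_def by (subst sum.swap, rule sum.cong[OF refl], subst sum.swap, rule refl)
  also have "\<dots> = (\<Sum>a<p. \<Sum>b<p. C a b * (if a = b then 1 else 0))"
  proof (intro sum.cong refl)
    fix a b assume "a \<in> {..<p}" "b \<in> {..<p}"
    then have "(\<Sum>k<p. u k a * u k b) = (if a = b then 1 else 0)"
      using orthonormal_column[OF u] by auto
    moreover have "(\<Sum>k<p. u k a * C a b * u k b) = C a b * (\<Sum>k<p. u k a * u k b)"
      unfolding sum_distrib_left by (rule sum.cong) auto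
    ultimately show "(\<Sum>k<p. u k a * C a b * u k b) = C a b * (if a = b then 1 else 0)"
      by simp
  qed
  also have "\<dots> = (\<Sum>a<p. C a a)" by (simp add: if_distrib cong: if_cong)
  finally show ?thesis .
qed

text \<open>Cauchy-Schwarz with the unit vector \<open>u k\<close> bounds each squared diagonal
  entry by \<open>|C u_k|^2\<close>; summed over \<open>k\<close>, Parseval applied to every row of
  \<open>C\<close> gives the squared Frobenius norm.\<close>

lemma orthonormal_sum_square_bform_le:
  assumes u: "orthonormal p u"
  shows "(\<Sum>k<p. (bform p C (u k) (u k))\<^sup>2) \<le> (\<Sum>a<p. \<Sum>b<p. (C a b)\<^sup>2)"
proof -
  have "(bform p C (u k) (u k))\<^sup>2 \<le> (\<Sum>a<p. (\<Sum>b<p. u k b * C a b)\<^sup>2)" if "k < p" for k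
  proof -
    have "bform p C (u k) (u k) = (\<Sum>a<p. u k a * (\<Sum>b<p. u k b * C a b))"
      by (simp add: bform_def sum_distrib_left mult_ac)
    then have "(bform p C (u k) (u k))\<^sup>2 \<le> (\<Sum>a<p. (u k a)\<^sup>2) * (\<Sum>a<p. (\<Sum>b<p. u k b * C a b)\<^sup>2)"
      using Cauchy_Schwarz_ineq_sum[of "u k"] by simp
    moreover have "(\<Sum>a<p. (u k a)\<^sup>2) = 1"
      using orthonormal_row[OF u that that] by (simp add: power2_eq_square)
    ultimately show ?thesis by simp
  qed
  then have "(\<Sum>k<p. (bform p C (u k) (u k))\<^sup>2) \<le> (\<Sum>k<p. \<Sum>a<p. (\<Sum>b<p. u k b * C a b)\<^sup>2)"
    by (intro sum_mono) auto
  also have "\<dots> = (\<Sum>a<p. \<Sum>k<p. (\<Sum>b<p. u k b * C a b) * (\<Sum>b<p. u k b * C a b))"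
    unfolding power2_eq_square by (rule sum.swap)
  also have "\<dots> = (\<Sum>a<p. \<Sum>b<p. (C a b)\<^sup>2)"
    unfolding orthonormal_parseval[OF u] by (simp add: power2_eq_square)
  finally show ?thesis .
qed

lemma bform_le_scaled:
  assumes "\<And>w. (\<Sum>a<p. (w a)\<^sup>2) = 1 \<Longrightarrow> bform p C w w \<le> c"
  shows "bform p C x x \<le> c * (\<Sum>a<p. (x a)\<^sup>2)"
proof (cases "(\<Sum>a<p. (x a)\<^sup>2) = 0")
  case True
  then have "\<forall>a<p. x a = 0" by (simp add: sum_nonneg_eq_0_iff)
  then have "bform p C x x = 0" by (simp add: bform_def)
  then show ?thesis using True by simp
next
  case False
  define r where "r = sqrt (\<Sum>a<p. (x a)\<^sup>2)"
  have r: "r\<^sup>2 = (\<Sum>a<p. (x a)\<^sup>2)" by (simp add: r_def sum_nonneg)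
  then have r0: "r \<noteq> 0" using False by auto
  have "(\<Sum>a<p. (1 / r * x a)\<^sup>2) = 1 / r\<^sup>2 * (\<Sum>a<p. (x a)\<^sup>2)"
    by (simp only: power_mult_distrib sum_distrib_left power_one_over)
  also have "\<dots> = 1" using r0 by (simp flip: r)
  finally have "bform p C (\<lambda>a. 1 / r * x a) (\<lambda>a. 1 / r * x a) \<le> c" by (rule assms)
  then have "1 / r * (1 / r * bform p C x x) \<le> c" by (simp only: bform_scale_left bform_scale_right)
  then have "bform p C x x / r\<^sup>2 \<le> c" by (simp add: power2_eq_square)
  then show ?thesis using r0 by (simp add: r pos_divide_le_eq flip: r)
qed

section \<open>Two-sided tails of the linear and the quadratic term\<close>

context prob_space
begin

lemma prob_abs_le:
  fixes X :: "'a \<Rightarrow> real"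
  assumes [measurable]: "X \<in> borel_measurable M"
    and "prob {\<omega> \<in> space M. X \<omega> > s} \<le> q" "prob {\<omega> \<in> space M. - X \<omega> > s} \<le> q"
  shows "prob {\<omega> \<in> space M. \<bar>X \<omega>\<bar> > s} \<le> 2 * q"
proof -
  have "prob {\<omega> \<in> space M. \<bar>X \<omega>\<bar> > s} \<le> prob ({\<omega> \<in> space M. X \<omega> > s} \<union> {\<omega> \<in> space M. - X \<omega> > s})"
    by (rule finite_measure_mono[OF _ sets.Un]) (auto simp: abs_real_def split: if_splits)
  also have "\<dots> \<le> prob {\<omega> \<in> space M. X \<omega> > s} + prob {\<omega> \<in> space M. - X \<omega> > s}"
    by (rule measure_Un_le) auto
  finally show ?thesis using assms(2,3) by linarith
qed

text \<open>The case \<open>c = 0\<close> of \<open>subexponential_tail\<close>: the exponential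
  moment of twice the pairing at \<open>t\<close> is
  \<open>exp (2 * t\<^sup>2 * bform p C s s)\<close>, valid for all \<open>t\<close>. The bound
  \<open>2 * V\<^sup>2\<close> on the form turns it into
  \<open>exp (4 * t\<^sup>2 * V\<^sup>2)\<close>.\<close>

lemma gaussian_linear_tail:
  assumes Z: "gaussian_transforms M p Z C" and V: "bform p C s s \<le> 2 * V\<^sup>2" "V \<ge> 0" and L: "L > 0"
  shows "prob {\<omega> \<in> space M. \<bar>2 * (\<Sum>a<p. s a * Z a \<omega>)\<bar> > 48 * (sqrt L * V)} \<le> 2 * exp (- 8 * L)"
proof (rule prob_abs_le)
  have [measurable]: "j < p \<Longrightarrow> Z j \<in> borel_measurable M" for j
    using Z by (simp add: gaussian_transforms_def)
  show m: "(\<lambda>\<omega>. 2 * (\<Sum>a<p. s a * Z a \<omega>)) \<in> borel_measurable M" by measurable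
  have mgf: "(\<integral>\<^sup>+\<omega>. ennreal (exp (t * (2 * (\<Sum>a<p. s a * Z a \<omega>)))) \<partial>M) \<le> ennreal (exp (4 * t\<^sup>2 * V\<^sup>2))" for t
  proof -
    have "bform p C (\<lambda>a. 2 * t * s a) (\<lambda>a. 2 * t * s a) / 2 \<le> 4 * t\<^sup>2 * V\<^sup>2"
      using mult_left_mono[OF V(1), of "2 * t\<^sup>2"]
      unfolding bform_scale_left bform_scale_right by (simp add: power2_eq_square)
    moreover have "has_bochner_integral M (\<lambda>\<omega>. exp (\<Sum>a<p. 2 * t * s a * Z a \<omega>))
        (exp (bform p C (\<lambda>a. 2 * t * s a) (\<lambda>a. 2 * t * s a) / 2))"
      using Z unfolding gaussian_transforms_def by fast
    then have "(\<integral>\<^sup>+\<omega>. ennreal (exp (\<Sum>a<p. 2 * t * s a * Z a \<omega>)) \<partial>M)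
        = ennreal (exp (bform p C (\<lambda>a. 2 * t * s a) (\<lambda>a. 2 * t * s a) / 2))"
      by (subst nn_integral_eq_integral) (auto simp: has_bochner_integral_iff)
    moreover have "(\<Sum>a<p. 2 * t * s a * Z a \<omega>) = t * (2 * (\<Sum>a<p. s a * Z a \<omega>))" for \<omega>
      by (simp add: sum_distrib_left mult_ac)
    ultimately show ?thesis by (simp add: ennreal_leI)
  qed
  have "prob {\<omega> \<in> space M. 48 * (sqrt L * V + L * 0) < 2 * (\<Sum>a<p. s a * Z a \<omega>)} \<le> exp (- 8 * L)"
    by (rule subexponential_tail[OF m L V(2) order.refl]) (rule mgf)
  then show "prob {\<omega> \<in> space M. 48 * (sqrt L * V) < 2 * (\<Sum>a<p. s a * Z a \<omega>)} \<le> exp (- 8 * L)"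
    by simp
  have m': "(\<lambda>\<omega>. - (2 * (\<Sum>a<p. s a * Z a \<omega>))) \<in> borel_measurable M" by measurable
  have "prob {\<omega> \<in> space M. 48 * (sqrt L * V + L * 0) < - (2 * (\<Sum>a<p. s a * Z a \<omega>))} \<le> exp (- 8 * L)"
  proof (rule subexponential_tail[OF m' L V(2) order.refl])
    show "(\<integral>\<^sup>+\<omega>. ennreal (exp (t * - (2 * (\<Sum>a<p. s a * Z a \<omega>)))) \<partial>M) \<le> ennreal (exp (4 * t\<^sup>2 * V\<^sup>2))" for t
      using mgf[of "- t"] by (simp only: mult_minus_left mult_minus_right power2_minus)
  qed
  then show "prob {\<omega> \<in> space M. 48 * (sqrt L * V) < - (2 * (\<Sum>a<p. s a * Z a \<omega>))} \<le> exp (- 8 * L)"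
    by (simp only: mult_zero_right add_0_right)
qed

text \<open>In an eigenbasis the transform is a product of inverse square roots, each bounded by an
  exponential. The eigenvalues sum to the trace, so centring removes the first-order term, and their
  squares sum to at most \<open>F\<^sup>2\<close>.\<close>

lemma gaussian_square_norm_tail:
  assumes Z: "gaussian_transforms M p Z C" and sym: "sym_mat p C" and psd: "\<And>w. 0 \<le> bform p C w w"
    and F: "(\<Sum>a<p. \<Sum>b<p. (C a b)\<^sup>2) \<le> F\<^sup>2" "F \<ge> 0"
    and cmax: "\<And>w. (\<Sum>a<p. (w a)\<^sup>2) = 1 \<Longrightarrow> bform p C w w \<le> cmax" "cmax \<ge> 0" and L: "L > 0"
  shows "prob {\<omega> \<in> space M. \<bar>(\<Sum>a<p. (Z a \<omega>)\<^sup>2) - (\<Sum>a<p. C a a)\<bar> > 48 * (sqrt L * F + L * cmax)}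
    \<le> 2 * exp (- 8 * L)"
proof (rule prob_abs_le)
  let ?X = "\<lambda>\<omega>. (\<Sum>a<p. (Z a \<omega>)\<^sup>2) - (\<Sum>a<p. C a a)"
  have [measurable]: "j < p \<Longrightarrow> Z j \<in> borel_measurable M" for j
    using Z by (simp add: gaussian_transforms_def)
  show m: "?X \<in> borel_measurable M" by measurable
  obtain u where u: "orthonormal p u" "\<And>k l. k < p \<Longrightarrow> l < p \<Longrightarrow> k \<noteq> l \<Longrightarrow> bform p C (u k) (u l) = 0"
    using symmetric_diagonalizable[OF sym] by blast
  define c where "c k = bform p C (u k) (u k)" for k
  have c0: "0 \<le> c k" for k by (simp add: c_def psd)
  have cle: "c k \<le> cmax" if "k < p" for k
    unfolding c_def by (rule cmax) (use orthonormal_row[OF u(1) that that] in \<open>simp add: power2_eq_square\<close>)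
  have tr: "(\<Sum>k<p. c k) = (\<Sum>a<p. C a a)" unfolding c_def by (rule orthonormal_trace[OF u(1)])
  have sq: "(\<Sum>k<p. (c k)\<^sup>2) \<le> F\<^sup>2"
    using orthonormal_sum_square_bform_le[OF u(1), of C] F(1) by (simp add: c_def)
  have mgf: "(\<integral>\<^sup>+\<omega>. ennreal (exp (t * ?X \<omega>)) \<partial>M) \<le> ennreal (exp (4 * t\<^sup>2 * F\<^sup>2))"
    if t: "4 * \<bar>t\<bar> * cmax \<le> 1" for t
  proof -
    \<comment> \<open>The range \<open>4 * |t| * cmax <= 1\<close> is exactly what puts every
      \<open>2 * t * c k\<close> into the domain of the logarithm expansion.\<close>
    have small: "\<bar>2 * t * c k\<bar> \<le> 1 / 2" if "k < p" for k
    proof -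
      have "\<bar>t\<bar> * c k \<le> \<bar>t\<bar> * cmax" using cle[OF that] by (intro mult_left_mono) auto
      then have "4 * (\<bar>t\<bar> * c k) \<le> 1" using t by linarith
      then show ?thesis using c0[of k] by (simp add: abs_mult)
    qed
    have "(\<integral>\<^sup>+\<omega>. ennreal (exp (t * (\<Sum>a<p. (Z a \<omega>)\<^sup>2))) \<partial>M) = ennreal (\<Prod>k<p. 1 / sqrt (1 - 2 * t * c k))"
    \<comment> \<open>One formula covers both signs, but by different routes: exponential moments
      for \<open>t >= 0\<close>, characteristic functions for \<open>t < 0\<close>. The negative
      sign gives the lower tail.\<close>
    proof (cases "t \<ge> 0")
      case True
      have lt: "2 * t * c k < 1" if "k < p" for k using small[OF that] by linarith
      show ?thesis
        by (rule gaussian_square_norm_mgf[OF Z u(1)]) (fact u(2) c_def True lt)+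
    next
      case False
      then have nonneg: "0 \<le> - t" by simp
      have "(\<integral>\<^sup>+\<omega>. ennreal (exp (- (- t) * (\<Sum>a<p. (Z a \<omega>)\<^sup>2))) \<partial>M) = ennreal (\<Prod>k<p. 1 / sqrt (1 + 2 * (- t) * c k))"
        by (rule gaussian_square_norm_laplace[OF Z u(1)]) (fact u(2) c_def nonneg | rule c0)+
      then show ?thesis by simp
    qed
    also have "\<dots> \<le> ennreal (\<Prod>k<p. exp (t * c k + 4 * t\<^sup>2 * (c k)\<^sup>2))"
    proof (intro ennreal_leI prod_mono conjI)
      fix k assume "k \<in> {..<p}"
      then show "1 / sqrt (1 - 2 * t * c k) \<le> exp (t * c k + 4 * t\<^sup>2 * (c k)\<^sup>2)"
        using inverse_sqrt_le_exp[OF small, of k] by (simp add: power_mult_distrib)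
      show "0 \<le> 1 / sqrt (1 - 2 * t * c k)"
        using small[of k] \<open>k \<in> {..<p}\<close> by auto
    qed
    also have "(\<Prod>k<p. exp (t * c k + 4 * t\<^sup>2 * (c k)\<^sup>2)) = exp (t * (\<Sum>a<p. C a a) + 4 * t\<^sup>2 * (\<Sum>k<p. (c k)\<^sup>2))"
      by (simp add: sum.distrib sum_distrib_left flip: exp_sum tr)
    also have "ennreal \<dots> \<le> ennreal (exp (t * (\<Sum>a<p. C a a) + 4 * t\<^sup>2 * F\<^sup>2))"
      using sq by (intro ennreal_leI) (simp add: mult_left_mono)
    finally have *: "(\<integral>\<^sup>+\<omega>. ennreal (exp (t * (\<Sum>a<p. (Z a \<omega>)\<^sup>2))) \<partial>M)
        \<le> ennreal (exp (t * (\<Sum>a<p. C a a) + 4 * t\<^sup>2 * F\<^sup>2))" .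
    have "(\<integral>\<^sup>+\<omega>. ennreal (exp (t * ?X \<omega>)) \<partial>M)
        = (\<integral>\<^sup>+\<omega>. ennreal (exp (- t * (\<Sum>a<p. C a a))) * ennreal (exp (t * (\<Sum>a<p. (Z a \<omega>)\<^sup>2))) \<partial>M)"
      by (intro nn_integral_cong) (simp add: right_diff_distrib flip: ennreal_mult exp_add)
    also have "\<dots> = ennreal (exp (- t * (\<Sum>a<p. C a a))) * (\<integral>\<^sup>+\<omega>. ennreal (exp (t * (\<Sum>a<p. (Z a \<omega>)\<^sup>2))) \<partial>M)"
      by (rule nn_integral_cmult) measurable
    also have "\<dots> \<le> ennreal (exp (- t * (\<Sum>a<p. C a a))) * ennreal (exp (t * (\<Sum>a<p. C a a) + 4 * t\<^sup>2 * F\<^sup>2))"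
      by (rule mult_left_mono[OF *]) simp
    also have "\<dots> = ennreal (exp (4 * t\<^sup>2 * F\<^sup>2))"
      by (simp flip: ennreal_mult exp_add)
    finally show ?thesis .
  qed
  show "prob {\<omega> \<in> space M. 48 * (sqrt L * F + L * cmax) < ?X \<omega>} \<le> exp (- 8 * L)"
    by (rule subexponential_tail[OF m L F(2) cmax(2)]) (use mgf in auto)
  have m': "(\<lambda>\<omega>. - ?X \<omega>) \<in> borel_measurable M" by measurable
  show "prob {\<omega> \<in> space M. 48 * (sqrt L * F + L * cmax) < - ?X \<omega>} \<le> exp (- 8 * L)"
  proof (rule subexponential_tail[OF m' L F(2) cmax(2)])
    fix t :: real assume "0 \<le> t" "4 * t * cmax \<le> 1"
    then have "(\<integral>\<^sup>+\<omega>. ennreal (exp (- t * ?X \<omega>)) \<partial>M) \<le> ennreal (exp (4 * (- t)\<^sup>2 * F\<^sup>2))"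
      by (intro mgf) simp
    then show "(\<integral>\<^sup>+\<omega>. ennreal (exp (t * - ?X \<omega>)) \<partial>M) \<le> ennreal (exp (4 * t\<^sup>2 * F\<^sup>2))"
      by (simp only: mult_minus_left mult_minus_right power2_minus)
  qed
qed

end

section \<open>Deviation of a single noisy distance\<close>

lemma vnorm_sq: "(vnorm p x)\<^sup>2 = (\<Sum>a<p. (x a)\<^sup>2)"
  by (simp add: vnorm_def sum_nonneg)

lemma vnorm_nonneg: "0 \<le> vnorm p x"
  by (simp add: vnorm_def sum_nonneg)

lemma vnorm_eq_L2_set: "vnorm p x = L2_set x {..<p}"
  by (simp add: vnorm_def L2_set_def)

lemma sym_psd_iff: "sym_psd p A \<longleftrightarrow> sym_mat p A \<and> (\<forall>w. 0 \<le> bform p A w w)"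
  by (simp add: sym_psd_def sym_mat_def bform_def)

text \<open>The covariance of \<open>Q Y\<close> when \<open>Y\<close> has covariance
  \<open>A\<close>.\<close>

abbreviation congr_mat :: "nat \<Rightarrow> (nat \<Rightarrow> nat \<Rightarrow> real) \<Rightarrow> (nat \<Rightarrow> nat \<Rightarrow> real) \<Rightarrow> nat \<Rightarrow> nat \<Rightarrow> real" where
  "congr_mat p Q A \<equiv> mmult p (mmult p Q A) (mtrans Q)"

lemma congr_mat_entry:
  assumes "a < p" "b < p"
  shows "congr_mat p Q A a b = bform p A (Q a) (Q b)"
proof -
  have "congr_mat p Q A a b = (\<Sum>c<p. \<Sum>d<p. Q a d * A d c * Q b c)"
    using assms by (simp add: mmult_def mtrans_def sum_distrib_right)
  also have "\<dots> = bform p A (Q a) (Q b)"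
    unfolding bform_def by (rule sum.swap)
  finally show ?thesis .
qed

lemma bform_congr_mat:
  "bform p (congr_mat p Q A) w w = bform p A (\<lambda>b. \<Sum>a<p. w a * Q a b) (\<lambda>b. \<Sum>a<p. w a * Q a b)"
proof -
  have "bform p (congr_mat p Q A) w w = (\<Sum>a<p. \<Sum>b<p. w a * bform p A (Q a) (Q b) * w b)"
    unfolding bform_def[of p "congr_mat p Q A"] by (intro sum.cong refl) (simp add: congr_mat_entry)
  also have "\<dots> = bform p A (\<lambda>b. \<Sum>a<p. w a * Q a b) (\<lambda>b. \<Sum>a<p. w a * Q a b)"
    unfolding bform_sum_left bform_sum_right bform_scale_left bform_scale_right
    by (simp add: sum_distrib_left mult_ac)
  finally show ?thesis .
qed

lemma sym_psd_congr_mat: "sym_psd p A \<Longrightarrow> sym_psd p (congr_mat p Q A)"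
  using bform_sym[of p A] by (simp add: sym_psd_iff bform_congr_mat sym_mat_def[of p "congr_mat p Q A"] congr_mat_entry)

lemma congr_mat_idm:
  assumes "a < p" "b < p"
  shows "congr_mat p (idm p) A a b = A a b"
proof -
  have "congr_mat p (idm p) A a b = (\<Sum>c<p. \<Sum>d<p. if c = a then (if d = b then A c d else 0) else 0)"
    using assms by (auto simp: congr_mat_entry bform_def idm_def intro!: sum.cong)
  also have "\<dots> = (\<Sum>c<p. if c = a then (\<Sum>d<p. if d = b then A c d else 0) else 0)"
    by (intro sum.cong refl) auto
  finally show ?thesis using assms by simp
qed

lemma trace_square_sym:
  assumes "sym_mat p A"
  shows "mtrace p (mmult p A A) = (\<Sum>a<p. \<Sum>b<p. (A a b)\<^sup>2)"
  using assms unfolding mtrace_def mmult_def sym_mat_def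
  by (intro sum.cong refl) (auto simp: power2_eq_square intro!: sum.cong)

text \<open>\<open>opnorm\<close> is a supremum of reals and bounds its members only once the set is
  known to be bounded; the Frobenius norm provides the bound.\<close>

lemma opnorm_bdd: "bdd_above {vnorm p (mvmult p A x) | x. vnorm p x \<le> 1}"
proof (rule bdd_aboveI)
  fix y assume "y \<in> {vnorm p (mvmult p A x) | x. vnorm p x \<le> 1}"
  then obtain x where x: "vnorm p x \<le> 1" and y: "y = vnorm p (mvmult p A x)" by auto
  have x1: "(\<Sum>b<p. (x b)\<^sup>2) \<le> 1"
    using power_mono[OF x vnorm_nonneg, of 2] by (simp add: vnorm_sq)
  have "(mvmult p A x a)\<^sup>2 \<le> (\<Sum>b<p. (A a b)\<^sup>2)" for a
  proof -
    have "(mvmult p A x a)\<^sup>2 \<le> (\<Sum>b<p. (A a b)\<^sup>2) * (\<Sum>b<p. (x b)\<^sup>2)"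
      unfolding mvmult_def by (rule Cauchy_Schwarz_ineq_sum)
    also have "\<dots> \<le> (\<Sum>b<p. (A a b)\<^sup>2) * 1"
      by (rule mult_left_mono[OF x1]) (simp add: sum_nonneg)
    finally show ?thesis by simp
  qed
  then show "y \<le> sqrt (\<Sum>a<p. \<Sum>b<p. (A a b)\<^sup>2)"
    unfolding y vnorm_def by (intro real_sqrt_le_mono sum_mono)
qed

lemma bform_le_opnorm:
  assumes x: "(\<Sum>a<p. (x a)\<^sup>2) = 1"
  shows "bform p A x x \<le> opnorm p A"
proof -
  have v: "vnorm p x = 1" using x by (simp add: vnorm_def)
  have "bform p A x x = (\<Sum>a<p. x a * mvmult p A x a)"
    by (simp add: bform_def mvmult_def sum_distrib_left mult_ac)
  also have "\<dots> \<le> (\<Sum>a<p. \<bar>x a\<bar> * \<bar>mvmult p A x a\<bar>)"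
    by (intro sum_mono) (simp flip: abs_mult)
  also have "\<dots> \<le> vnorm p x * vnorm p (mvmult p A x)"
    unfolding vnorm_eq_L2_set by (rule L2_set_mult_ineq)
  also have "\<dots> \<le> opnorm p A"
    unfolding opnorm_def using v by (simp, intro cSup_upper opnorm_bdd) auto
  finally show ?thesis .
qed

section \<open>Tail of the deviation for one triple\<close>

context prob_space
begin

text \<open>The deviation is \<open>|lin + quad|\<close>. The threshold 96 is shared out as 48 for
  each part, with \<open>V = 2 * \<sigma> * R\<close> in the linear tail and
  \<open>F = 2 * t\<close>, \<open>cmax = 2 * \<sigma>\<^sup>2\<close> in the quadratic one; each
  part fails with probability at most \<open>2 * exp (- 8 * L)\<close>.\<close>

lemma distance_deviation_tail:
  fixes X Y :: "nat \<Rightarrow> 'a \<Rightarrow> real" and x y :: "nat \<Rightarrow> real" and A B Q :: "nat \<Rightarrow> nat \<Rightarrow> real" and p :: nat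
  defines "B' \<equiv> congr_mat p Q B"
  defines "dev \<equiv> (\<lambda>\<omega>. \<bar>(vnorm p (\<lambda>a. (x a + X a \<omega>) - mvmult p Q (\<lambda>b. y b + Y b \<omega>) a))\<^sup>2
          - (vnorm p (\<lambda>a. x a - mvmult p Q y a))\<^sup>2 - mtrace p (\<lambda>a b. A a b + B' a b)\<bar>)"
  assumes X: "gaussian_vec M p X A" and Y: "gaussian_vec M p Y B"
    and A: "sym_psd p A" and B: "sym_psd p B"
    and ind: "indep_var (PiM {..<p} (\<lambda>_. borel)) (\<lambda>\<omega>. restrict (\<lambda>j. X j \<omega>) {..<p})
      (PiM {..<p} (\<lambda>_. borel)) (\<lambda>\<omega>. restrict (\<lambda>j. Y j \<omega>) {..<p})"
    and t: "(\<Sum>a<p. \<Sum>b<p. (A a b)\<^sup>2) \<le> t\<^sup>2" "(\<Sum>a<p. \<Sum>b<p. (B' a b)\<^sup>2) \<le> t\<^sup>2" "0 \<le> t"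
    and \<sigma>: "\<And>w. (\<Sum>a<p. (w a)\<^sup>2) = 1 \<Longrightarrow> bform p A w w \<le> \<sigma>\<^sup>2"
      "\<And>w. (\<Sum>a<p. (w a)\<^sup>2) = 1 \<Longrightarrow> bform p B' w w \<le> \<sigma>\<^sup>2" "0 \<le> \<sigma>"
    and R: "vnorm p x \<le> R" "vnorm p (mvmult p Q y) \<le> R" and L: "0 < L"
  shows "dev \<in> borel_measurable M"
    and "prob {\<omega> \<in> space M. 96 * (sqrt L * (t + \<sigma> * R) + L * \<sigma>\<^sup>2) < dev \<omega>} \<le> 4 * exp (- 8 * L)"
proof -
  define s where "s a = x a - mvmult p Q y a" for a
  define Z where "Z a \<omega> = X a \<omega> - mvmult p Q (\<lambda>b. Y b \<omega>) a" for a \<omega>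
  define C where "C a b = A a b + B' a b" for a b
  have bC: "bform p C w w = bform p A w w + bform p B' w w" for w
    by (simp add: C_def bform_def algebra_simps sum.distrib)
  have Z: "gaussian_transforms M p Z C"
    unfolding Z_def
    by (rule gaussian_transforms_diff[OF gaussian_vec_transforms[OF X A] gaussian_vec_transforms[OF Y B] ind])
      (simp add: bC B'_def bform_congr_mat)
  then have Zm[measurable]: "j < p \<Longrightarrow> Z j \<in> borel_measurable M" for j
    by (simp add: gaussian_transforms_def)
  have B': "sym_psd p B'" unfolding B'_def by (rule sym_psd_congr_mat[OF B])
  have C: "sym_mat p C"
    using A B' by (simp add: sym_psd_iff sym_mat_def C_def)
  have R0: "0 \<le> R" using R(1) vnorm_nonneg[of p x] by linarith
  define lin where "lin \<omega> = 2 * (\<Sum>a<p. s a * Z a \<omega>)" for \<omega>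
  define quad where "quad \<omega> = (\<Sum>a<p. (Z a \<omega>)\<^sup>2) - (\<Sum>a<p. C a a)" for \<omega>
  have [measurable]: "lin \<in> borel_measurable M" "quad \<in> borel_measurable M"
    unfolding lin_def[abs_def] quad_def[abs_def] by measurable
  have dev: "dev \<omega> = \<bar>lin \<omega> + quad \<omega>\<bar>" for \<omega>
  proof -
    have "(x a + X a \<omega>) - mvmult p Q (\<lambda>b. y b + Y b \<omega>) a = s a + Z a \<omega>" for a
      by (simp add: s_def Z_def mvmult_def algebra_simps sum.distrib)
    then have "dev \<omega> = \<bar>(\<Sum>a<p. (s a + Z a \<omega>)\<^sup>2) - (\<Sum>a<p. (s a)\<^sup>2) - (\<Sum>a<p. C a a)\<bar>"
      unfolding dev_def vnorm_sq mtrace_def by (simp only: s_def C_def)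
    also have "(\<Sum>a<p. (s a + Z a \<omega>)\<^sup>2) = (\<Sum>a<p. (s a)\<^sup>2) + lin \<omega> + (\<Sum>a<p. (Z a \<omega>)\<^sup>2)"
      by (simp add: lin_def power2_sum sum.distrib sum_distrib_left algebra_simps)
    finally show ?thesis by (simp add: quad_def)
  qed
  show dm: "dev \<in> borel_measurable M"
    unfolding dev[abs_def] by measurable
  have frob: "(\<Sum>a<p. \<Sum>b<p. (C a b)\<^sup>2) \<le> (2 * t)\<^sup>2"
  proof -
    have "(C a b)\<^sup>2 \<le> 2 * (A a b)\<^sup>2 + 2 * (B' a b)\<^sup>2" for a b
      using sum_squares_bound[of "A a b" "B' a b"] by (simp add: C_def power2_sum)
    then have "(\<Sum>a<p. \<Sum>b<p. (C a b)\<^sup>2) \<le> (\<Sum>a<p. \<Sum>b<p. 2 * (A a b)\<^sup>2 + 2 * (B' a b)\<^sup>2)"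
      by (intro sum_mono)
    also have "\<dots> = 2 * (\<Sum>a<p. \<Sum>b<p. (A a b)\<^sup>2) + 2 * (\<Sum>a<p. \<Sum>b<p. (B' a b)\<^sup>2)"
      by (simp add: sum.distrib sum_distrib_left)
    finally show ?thesis using t by (simp add: power_mult_distrib)
  qed
  have unit: "bform p C w w \<le> 2 * \<sigma>\<^sup>2" if "(\<Sum>a<p. (w a)\<^sup>2) = 1" for w
    using \<sigma>(1,2)[OF that] by (simp add: bC)
  have "vnorm p s \<le> 2 * R"
  proof -
    have "vnorm p s = L2_set (\<lambda>a. x a + - mvmult p Q y a) {..<p}"
      by (simp add: vnorm_eq_L2_set s_def[abs_def])
    also have "\<dots> \<le> L2_set x {..<p} + L2_set (\<lambda>a. - mvmult p Q y a) {..<p}"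
      by (rule L2_set_triangle_ineq)
    also have "\<dots> = vnorm p x + vnorm p (mvmult p Q y)"
      by (simp add: vnorm_eq_L2_set L2_set_def)
    finally show ?thesis using R by linarith
  qed
  then have "(vnorm p s)\<^sup>2 \<le> (2 * R)\<^sup>2" by (rule power_mono) (rule vnorm_nonneg)
  then have "2 * \<sigma>\<^sup>2 * (\<Sum>a<p. (s a)\<^sup>2) \<le> 2 * \<sigma>\<^sup>2 * (2 * R)\<^sup>2"
    by (intro mult_left_mono) (auto simp: vnorm_sq)
  \<comment> \<open>The norm of \<open>s\<close> is at most \<open>2 * R\<close> and the form is at
    most \<open>2 * \<sigma>\<^sup>2\<close> on unit vectors; the product is arranged as
    \<open>2 * V\<^sup>2\<close> to fit the linear tail.\<close>
  then have V: "bform p C s s \<le> 2 * (2 * \<sigma> * R)\<^sup>2"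
    using bform_le_scaled[OF unit, of s] by (simp add: power_mult_distrib mult_ac)
  have plin: "prob {\<omega> \<in> space M. 48 * (sqrt L * (2 * \<sigma> * R)) < \<bar>lin \<omega>\<bar>} \<le> 2 * exp (- 8 * L)"
    unfolding lin_def using gaussian_linear_tail[OF Z V _ L] \<sigma>(3) R0 by simp
  have pquad: "prob {\<omega> \<in> space M. 48 * (sqrt L * (2 * t) + L * (2 * \<sigma>\<^sup>2)) < \<bar>quad \<omega>\<bar>} \<le> 2 * exp (- 8 * L)"
    unfolding quad_def
    by (rule gaussian_square_norm_tail[OF Z C _ frob _ unit])
      (use A B' t L in \<open>auto simp: bC sym_psd_iff\<close>)
  have "prob {\<omega> \<in> space M. 96 * (sqrt L * (t + \<sigma> * R) + L * \<sigma>\<^sup>2) < dev \<omega>}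
     \<le> prob ({\<omega> \<in> space M. 48 * (sqrt L * (2 * \<sigma> * R)) < \<bar>lin \<omega>\<bar>} \<union>
        {\<omega> \<in> space M. 48 * (sqrt L * (2 * t) + L * (2 * \<sigma>\<^sup>2)) < \<bar>quad \<omega>\<bar>})"
  proof (rule finite_measure_mono)
    have "96 * (sqrt L * (t + \<sigma> * R) + L * \<sigma>\<^sup>2)
        = 48 * (sqrt L * (2 * \<sigma> * R)) + 48 * (sqrt L * (2 * t) + L * (2 * \<sigma>\<^sup>2))"
      by (simp add: algebra_simps)
    then show "{\<omega> \<in> space M. 96 * (sqrt L * (t + \<sigma> * R) + L * \<sigma>\<^sup>2) < dev \<omega>} \<subseteq>
        {\<omega> \<in> space M. 48 * (sqrt L * (2 * \<sigma> * R)) < \<bar>lin \<omega>\<bar>} \<union>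
        {\<omega> \<in> space M. 48 * (sqrt L * (2 * t) + L * (2 * \<sigma>\<^sup>2)) < \<bar>quad \<omega>\<bar>}"
      unfolding dev by auto
  qed measurable
  also have "\<dots> \<le> prob {\<omega> \<in> space M. 48 * (sqrt L * (2 * \<sigma> * R)) < \<bar>lin \<omega>\<bar>} +
      prob {\<omega> \<in> space M. 48 * (sqrt L * (2 * t) + L * (2 * \<sigma>\<^sup>2)) < \<bar>quad \<omega>\<bar>}"
    by (rule measure_Un_le) measurable
  finally show "prob {\<omega> \<in> space M. 96 * (sqrt L * (t + \<sigma> * R) + L * \<sigma>\<^sup>2) < dev \<omega>} \<le> 4 * exp (- 8 * L)"
    using plin pquad by linarith
qed

end

section \<open>Union bound\<close>

text \<open>Families restricted to the disjoint index sets \<open>{i}\<close> and \<open>{j}\<close>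
  are independent; evaluation at the single index recovers the variables.\<close>

lemma (in prob_space) indep_vars_pair:
  assumes "indep_vars M' X I" "i \<in> I" "j \<in> I" "i \<noteq> j"
  shows "indep_var (M' i) (X i) (M' j) (X j)"
proof -
  have "indep_var (M' i) ((\<lambda>f. f i) \<circ> (\<lambda>\<omega>. restrict (\<lambda>i. X i \<omega>) {i}))
      (M' j) ((\<lambda>f. f j) \<circ> (\<lambda>\<omega>. restrict (\<lambda>i. X i \<omega>) {j}))"
    using assms(2-4) by (intro indep_var_compose[OF indep_var_restrict[OF assms(1)]]) auto
  then show ?thesis by (simp add: comp_def)
qed

text \<open>Union bound. The inserted \<open>0\<close> gives the maximum a value when
  \<open>J\<close> is empty, and by \<open>0 <= s\<close> it never exceeds the threshold
  itself.\<close>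

lemma (in prob_space) prob_Max_gt_le:
  fixes f :: "'i \<Rightarrow> 'a \<Rightarrow> real"
  assumes J: "finite J" and f: "\<And>x. x \<in> J \<Longrightarrow> f x \<in> borel_measurable M"
    and q: "\<And>x. x \<in> J \<Longrightarrow> prob {\<omega> \<in> space M. f x \<omega> > s} \<le> q" and s: "0 \<le> s"
  shows "prob {\<omega> \<in> space M. Max (insert 0 ((\<lambda>x. f x \<omega>) ` J)) > s} \<le> real (card J) * q"
proof -
  have [measurable]: "{\<omega> \<in> space M. f x \<omega> > s} \<in> events" if "x \<in> J" for x
    using f[OF that] by measurable
  have "prob {\<omega> \<in> space M. Max (insert 0 ((\<lambda>x. f x \<omega>) ` J)) > s} \<le> prob (\<Union>x\<in>J. {\<omega> \<in> space M. f x \<omega> > s})"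
  proof (rule finite_measure_mono)
    show "{\<omega> \<in> space M. Max (insert 0 ((\<lambda>x. f x \<omega>) ` J)) > s} \<subseteq> (\<Union>x\<in>J. {\<omega> \<in> space M. f x \<omega> > s})"
      using J s by (auto simp: Max_gr_iff)
    show "(\<Union>x\<in>J. {\<omega> \<in> space M. f x \<omega> > s}) \<in> events"
      using J by (intro sets.finite_UN) auto
  qed
  also have "\<dots> \<le> (\<Sum>x\<in>J. prob {\<omega> \<in> space M. f x \<omega> > s})"
    using J by (intro finite_measure_subadditive_finite) auto
  also have "\<dots> \<le> (\<Sum>x\<in>J. q)" by (intro sum_mono q)
  finally show ?thesis by simp
qed

text \<open>Non-asymptotic form with explicit constants. Membership of the identity in
  \<open>T\<close> lets \<open>tp\<close>, \<open>sp\<close> and \<open>R\<close> also control the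
  untransformed \<open>Sig i\<close> and \<open>S i\<close>; \<open>n >= 2\<close> makes
  \<open>L\<close> positive.\<close>

lemma (in prob_space) sup_distance_deviation_tail:
  fixes n p :: nat and S :: "nat \<Rightarrow> nat \<Rightarrow> real" and Sig :: "nat \<Rightarrow> nat \<Rightarrow> nat \<Rightarrow> real"
    and N :: "nat \<Rightarrow> nat \<Rightarrow> 'a \<Rightarrow> real" and T :: "(nat \<Rightarrow> nat \<Rightarrow> real) set"
  defines "L \<equiv> ln (real (card T) * (real n)\<^sup>2)"
    and "tp \<equiv> Max (insert 0 {sqrt (mtrace p (let C = congr_mat p Q (Sig i) in mmult p C C)) | Q i. Q \<in> T \<and> i < n})"
    and "sp \<equiv> Max (insert 0 {sqrt (opnorm p (congr_mat p Q (Sig i))) | Q i. Q \<in> T \<and> i < n})"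
    and "R \<equiv> Max (insert 0 {vnorm p (mvmult p Q (S i)) | Q i. Q \<in> T \<and> i < n})"
  assumes psd: "\<And>i. i < n \<Longrightarrow> sym_psd p (Sig i)"
    and gauss: "\<And>i. i < n \<Longrightarrow> gaussian_vec M p (N i) (Sig i)"
    and indep: "indep_vars (\<lambda>_. PiM {..<p} (\<lambda>_. borel)) (\<lambda>i \<omega>. restrict (\<lambda>j. N i j \<omega>) {..<p}) {..<n}"
    and T: "finite T" "idm p \<in> T" and n: "n \<ge> 2"
  shows "0 \<le> sqrt L * (tp + sp * R) + L * sp\<^sup>2"
    and "prob {\<omega> \<in> space M. 96 * (sqrt L * (tp + sp * R) + L * sp\<^sup>2) < Max (insert 0
        {\<bar>(vnorm p (\<lambda>a. (S i a + N i a \<omega>) - mvmult p Q (\<lambda>b. S j b + N j b \<omega>) a))\<^sup>2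
          - (vnorm p (\<lambda>a. S i a - mvmult p Q (S j) a))\<^sup>2
          - mtrace p (\<lambda>a b. Sig i a b + congr_mat p Q (Sig j) a b)\<bar>
         | Q i j. Q \<in> T \<and> i < n \<and> j < n \<and> i \<noteq> j})} \<le> 4 / (real n)\<^sup>2"
proof -
  have image2: "{g Q i | Q i. Q \<in> T \<and> i < n} = (\<lambda>(Q, i). g Q i) ` (T \<times> {..<n})"
    for g :: "(nat \<Rightarrow> nat \<Rightarrow> real) \<Rightarrow> nat \<Rightarrow> real" by auto
  have Max_ge2: "g Q i \<le> Max (insert 0 {g Q i | Q i. Q \<in> T \<and> i < n})" if "Q \<in> T" "i < n"
    for g :: "(nat \<Rightarrow> nat \<Rightarrow> real) \<Rightarrow> nat \<Rightarrow> real" and Q i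
    unfolding image2 using T(1) that by (intro Max_ge) (auto intro!: rev_image_eqI[of "(Q, i)"])
  have Max_0: "0 \<le> Max (insert 0 {g Q i | Q i. Q \<in> T \<and> i < n})"
    for g :: "(nat \<Rightarrow> nat \<Rightarrow> real) \<Rightarrow> nat \<Rightarrow> real"
    unfolding image2 using T(1) by (intro Max_ge) auto
  have tp0: "0 \<le> tp" and sp0: "0 \<le> sp" and R0: "0 \<le> R"
    unfolding tp_def sp_def R_def by (rule Max_0)+
  have card: "real (card T) \<ge> 1" using T by (cases "card T") auto
  have n4: "(real n)\<^sup>2 \<ge> 4" using power_mono[of 2 "real n" 2] n by simp
  have big: "real (card T) * (real n)\<^sup>2 \<ge> (real n)\<^sup>2"
    using mult_right_mono[OF card, of "(real n)\<^sup>2"] by simp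
  then have L0: "0 < L" and expL: "exp L = real (card T) * (real n)\<^sup>2"
    unfolding L_def using n4 by (auto intro!: ln_gt_zero)
  show B0: "0 \<le> sqrt L * (tp + sp * R) + L * sp\<^sup>2"
    using tp0 sp0 R0 L0 by simp
  define f where "f = (\<lambda>(Q, i, j) \<omega>. \<bar>(vnorm p (\<lambda>a. (S i a + N i a \<omega>) - mvmult p Q (\<lambda>b. S j b + N j b \<omega>) a))\<^sup>2
          - (vnorm p (\<lambda>a. S i a - mvmult p Q (S j) a))\<^sup>2
          - mtrace p (\<lambda>a b. Sig i a b + congr_mat p Q (Sig j) a b)\<bar>)"
  define J where "J = {(Q, i, j). Q \<in> T \<and> i < n \<and> j < n \<and> i \<noteq> j}"
  have Jsub: "J \<subseteq> T \<times> {..<n} \<times> {..<n}" by (auto simp: J_def)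
  have J: "finite J" by (rule finite_subset[OF Jsub]) (use T in auto)
  \<comment> \<open>\<open>L\<close> is chosen so that \<open>exp L\<close> is the size of the full
    product of \<open>T\<close> with two index ranges, which contains all triples.\<close>
  have cJ: "real (card J) \<le> exp L"
    using card_mono[OF _ Jsub] T(1) unfolding expL
    by (simp add: card_cartesian_product power2_eq_square flip: of_nat_mult)
  have frob: "(\<Sum>a<p. \<Sum>b<p. (congr_mat p Q (Sig i) a b)\<^sup>2) \<le> tp\<^sup>2" if "Q \<in> T" "i < n" for Q i
  proof -
    have "sym_mat p (congr_mat p Q (Sig i))"
      using sym_psd_congr_mat[OF psd[OF that(2)]] by (simp add: sym_psd_iff)
    then have "sqrt (\<Sum>a<p. \<Sum>b<p. (congr_mat p Q (Sig i) a b)\<^sup>2) \<le> tp"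
      using Max_ge2[OF that, of "\<lambda>Q i. sqrt (mtrace p (let C = congr_mat p Q (Sig i) in mmult p C C))"]
      unfolding tp_def by (simp add: trace_square_sym Let_def)
    then show ?thesis by (rule sqrt_le_D)
  qed
  have op: "bform p (congr_mat p Q (Sig i)) w w \<le> sp\<^sup>2"
    if "Q \<in> T" "i < n" "(\<Sum>a<p. (w a)\<^sup>2) = 1" for Q i w
  proof -
    have "sqrt (opnorm p (congr_mat p Q (Sig i))) \<le> sp"
      unfolding sp_def by (rule Max_ge2) fact+
    then show ?thesis using bform_le_opnorm[OF that(3)] sqrt_le_D by (meson order_trans)
  qed
  have RS: "vnorm p (mvmult p Q (S i)) \<le> R" if "Q \<in> T" "i < n" for Q i
    unfolding R_def by (rule Max_ge2) fact+
  have RS_id: "vnorm p (S i) \<le> R" if "i < n" for i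
  proof -
    have "mvmult p (idm p) (S i) a = S i a" if "a < p" for a
      using that by (simp add: mvmult_def idm_def if_distrib[of "\<lambda>r. r * _"] cong: if_cong)
    then show ?thesis using RS[OF T(2) that] by (simp add: vnorm_def)
  qed
  have tail: "f z \<in> borel_measurable M \<and>
      prob {\<omega> \<in> space M. 96 * (sqrt L * (tp + sp * R) + L * sp\<^sup>2) < f z \<omega>} \<le> 4 * exp (- 8 * L)" if "z \<in> J" for z
  proof -
    obtain Q i j where z: "z = (Q, i, j)" and Q: "Q \<in> T" and i: "i < n" and j: "j < n" and ij: "i \<noteq> j"
      using \<open>z \<in> J\<close> by (auto simp: J_def)
    note ind = indep_vars_pair[OF indep, of i j, simplified, OF i j ij]
    have frob_i: "(\<Sum>a<p. \<Sum>b<p. (Sig i a b)\<^sup>2) \<le> tp\<^sup>2"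
      using frob[OF T(2) i] by (simp add: congr_mat_idm)
    have op_i: "bform p (Sig i) w w \<le> sp\<^sup>2" if "(\<Sum>a<p. (w a)\<^sup>2) = 1" for w
      using op[OF T(2) i that] bform_cong[of p "congr_mat p (idm p) (Sig i)" "Sig i" w w w w]
      by (simp add: congr_mat_idm)
    note dev = distance_deviation_tail[OF gauss[OF i] gauss[OF j] psd[OF i] psd[OF j] ind
        frob_i frob[OF Q j] tp0 op_i op[OF Q j] sp0 RS_id[OF i] RS[OF Q j] L0]
    show ?thesis using dev unfolding z f_def prod.case by blast
  qed
  have "{\<bar>(vnorm p (\<lambda>a. (S i a + N i a \<omega>) - mvmult p Q (\<lambda>b. S j b + N j b \<omega>) a))\<^sup>2
          - (vnorm p (\<lambda>a. S i a - mvmult p Q (S j) a))\<^sup>2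
          - mtrace p (\<lambda>a b. Sig i a b + congr_mat p Q (Sig j) a b)\<bar>
         | Q i j. Q \<in> T \<and> i < n \<and> j < n \<and> i \<noteq> j} = (\<lambda>z. f z \<omega>) ` J" for \<omega>
    unfolding f_def J_def by force
  moreover have "prob {\<omega> \<in> space M. 96 * (sqrt L * (tp + sp * R) + L * sp\<^sup>2) < Max (insert 0 ((\<lambda>z. f z \<omega>) ` J))}
      \<le> real (card J) * (4 * exp (- 8 * L))"
    by (rule prob_Max_gt_le[OF J]) (use tail B0 in auto)
  moreover have "real (card J) * (4 * exp (- 8 * L)) \<le> 4 / (real n)\<^sup>2"
  \<comment> \<open>The union costs a factor \<open>exp L\<close>, leaving
    \<open>4 * exp (- 7 * L)\<close>. This is weakened to \<open>4 * exp (- L)\<close>, which is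
    \<open>4 / (card T * n^2)\<close> and already tends to 0 as \<open>n\<close> grows.\<close>
  proof -
    have "real (card J) * (4 * exp (- 8 * L)) \<le> exp L * (4 * exp (- 8 * L))"
      by (rule mult_right_mono[OF cJ]) simp
    also have "\<dots> = 4 * exp (- 7 * L)" by (simp flip: exp_add)
    also have "\<dots> \<le> 4 * exp (- L)" using L0 by simp
    also have "\<dots> = 4 / (real (card T) * (real n)\<^sup>2)" by (simp add: exp_minus expL divide_inverse)
    also have "\<dots> \<le> 4 / (real n)\<^sup>2" by (rule frac_le) (use big n4 in linarith)+
    finally show ?thesis .
  qed
  ultimately show "prob {\<omega> \<in> space M. 96 * (sqrt L * (tp + sp * R) + L * sp\<^sup>2) < Max (insert 0
        {\<bar>(vnorm p (\<lambda>a. (S i a + N i a \<omega>) - mvmult p Q (\<lambda>b. S j b + N j b \<omega>) a))\<^sup>2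
          - (vnorm p (\<lambda>a. S i a - mvmult p Q (S j) a))\<^sup>2
          - mtrace p (\<lambda>a b. Sig i a b + congr_mat p Q (Sig j) a b)\<bar>
         | Q i j. Q \<in> T \<and> i < n \<and> j < n \<and> i \<noteq> j})} \<le> 4 / (real n)\<^sup>2"
    by simp
qed

theorem theorem2p1:
  fixes M :: "nat \<Rightarrow> 'a measure"
    and n p :: "nat \<Rightarrow> nat"
    and S :: "nat \<Rightarrow> nat \<Rightarrow> nat \<Rightarrow> real"
    and Sig :: "nat \<Rightarrow> nat \<Rightarrow> nat \<Rightarrow> nat \<Rightarrow> real"
    and N :: "nat \<Rightarrow> nat \<Rightarrow> nat \<Rightarrow> 'a \<Rightarrow> real"
    and T :: "nat \<Rightarrow> (nat \<Rightarrow> nat \<Rightarrow> real) set"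
  assumes n_lim: "filterlim n at_top sequentially"
    and p_lim: "filterlim p at_top sequentially"
    and prob: "\<And>m. prob_space (M m)"
    and Sig_psd: "\<And>m i. i < n m \<Longrightarrow> sym_psd (p m) (Sig m i)"
    and gauss: "\<And>m i. i < n m \<Longrightarrow> gaussian_vec (M m) (p m) (N m i) (Sig m i)"
    and indep: "\<And>m. prob_space.indep_vars (M m) (\<lambda>_. PiM {..<p m} (\<lambda>_. borel))
                  (\<lambda>i \<omega>. restrict (\<lambda>j. N m i j \<omega>) {..<p m}) {..<n m}"
    and T_fin: "\<And>m. finite (T m)"
    and T_mat: "\<And>m Q. Q \<in> T m \<Longrightarrow> is_mat (p m) Q"
    and T_id: "\<And>m. idm (p m) \<in> T m"
  shows "bigOP M
     (\<lambda>m \<omega>. Max (insert 0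
        {\<bar>(vnorm (p m) (\<lambda>a. (S m i a + N m i a \<omega>) - mvmult (p m) Q (\<lambda>b. S m j b + N m j b \<omega>) a))^2
          - (vnorm (p m) (\<lambda>a. S m i a - mvmult (p m) Q (S m j) a))^2
          - mtrace (p m) (\<lambda>a b. Sig m i a b + mmult (p m) (mmult (p m) Q (Sig m j)) (mtrans Q) a b)\<bar>
         | Q i j. Q \<in> T m \<and> i < n m \<and> j < n m \<and> i \<noteq> j}))
     (\<lambda>m. let L = ln (real (card (T m)) * (real (n m))^2);
              tp = Max (insert 0 {sqrt (mtrace (p m)
                      (let C = mmult (p m) (mmult (p m) Q (Sig m i)) (mtrans Q) in mmult (p m) C C))
                      | Q i. Q \<in> T m \<and> i < n m});
              sp = Max (insert 0 {sqrt (opnorm (p m) (mmult (p m) (mmult (p m) Q (Sig m i)) (mtrans Q)))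
                      | Q i. Q \<in> T m \<and> i < n m});
              R = Max (insert 0 {vnorm (p m) (mvmult (p m) Q (S m i)) | Q i. Q \<in> T m \<and> i < n m})
          in sqrt L * (tp + sp * R) + L * sp^2)"
proof -
  let ?B = "\<lambda>m. let L = ln (real (card (T m)) * (real (n m))^2);
              tp = Max (insert 0 {sqrt (mtrace (p m)
                      (let C = mmult (p m) (mmult (p m) Q (Sig m i)) (mtrans Q) in mmult (p m) C C))
                      | Q i. Q \<in> T m \<and> i < n m});
              sp = Max (insert 0 {sqrt (opnorm (p m) (mmult (p m) (mmult (p m) Q (Sig m i)) (mtrans Q)))
                      | Q i. Q \<in> T m \<and> i < n m});
              R = Max (insert 0 {vnorm (p m) (mvmult (p m) Q (S m i)) | Q i. Q \<in> T m \<and> i < n m})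
          in sqrt L * (tp + sp * R) + L * sp^2"
  let ?D = "\<lambda>m \<omega>. Max (insert 0
        {\<bar>(vnorm (p m) (\<lambda>a. (S m i a + N m i a \<omega>) - mvmult (p m) Q (\<lambda>b. S m j b + N m j b \<omega>) a))^2
          - (vnorm (p m) (\<lambda>a. S m i a - mvmult (p m) Q (S m j) a))^2
          - mtrace (p m) (\<lambda>a b. Sig m i a b + mmult (p m) (mmult (p m) Q (Sig m j)) (mtrans Q) a b)\<bar>
         | Q i j. Q \<in> T m \<and> i < n m \<and> j < n m \<and> i \<noteq> j})"
  have abs_D: "\<bar>?D m \<omega>\<bar> = ?D m \<omega>" for m \<omega>
  proof -
    have "finite ((\<lambda>(Q, i, j). g Q i j) ` (T m \<times> {..<n m} \<times> {..<n m}))"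
      for g :: "(nat \<Rightarrow> nat \<Rightarrow> real) \<Rightarrow> nat \<Rightarrow> nat \<Rightarrow> real"
      using T_fin by simp
    then have "finite {g Q i j | Q i j. Q \<in> T m \<and> i < n m \<and> j < n m \<and> i \<noteq> j}"
      for g :: "(nat \<Rightarrow> nat \<Rightarrow> real) \<Rightarrow> nat \<Rightarrow> nat \<Rightarrow> real"
      by (rule finite_subset[rotated]) force
    then show ?thesis by (intro abs_of_nonneg Max_ge) auto
  qed
  have tail: "measure (M m) {\<omega> \<in> space (M m). 96 * ?B m < ?D m \<omega>} \<le> 4 / (real (n m))^2" if "n m \<ge> 2" for m
  proof -
    interpret prob_space "M m" by (rule prob)
    show ?thesis
      \<comment> \<open>Only the outer bindings are unfolded; the inner \<open>let C\<close>
        remains, as in the lemma being applied.\<close>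
      unfolding Let_def[of "ln _"] Let_def[of "Max _"]
      by (rule sup_distance_deviation_tail(2)[OF Sig_psd gauss indep T_fin T_id that])
  qed
  show ?thesis
    unfolding bigOP_def
  \<comment> \<open>The constant 96 serves every \<delta> at once, because the failure probability
    \<open>4 / n^2\<close> itself tends to 0.\<close>
  proof (intro allI impI exI[of _ 96])
    fix \<delta> :: real assume \<delta>: "0 < \<delta>"
    \<comment> \<open>The summand 2 gives both \<open>n m >= 2\<close> and the strict inequality
      \<open>n m > 4 / \<delta>\<close>; then \<open>4 / n^2 <= 4 / n < \<delta>\<close>.\<close>
    have "eventually (\<lambda>m. n m \<ge> nat \<lceil>4 / \<delta>\<rceil> + 2) sequentially"
      using n_lim by (simp add: filterlim_at_top)
    then show "eventually (\<lambda>m. measure (M m) {\<omega> \<in> space (M m). 96 * ?B m < \<bar>?D m \<omega>\<bar>} < \<delta>) sequentially"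
    proof eventually_elim
      case (elim m)
      then have n2: "n m \<ge> 2" and "real (n m) > 4 / \<delta>" by linarith+
      then have "4 / real (n m) < \<delta>" using \<delta> by (simp add: field_simps)
      moreover have "4 / (real (n m))^2 \<le> 4 / real (n m)"
        using n2 by (intro divide_left_mono) (auto simp: power2_eq_square)
      ultimately show ?case unfolding abs_D using tail[OF n2] by linarith
    qed
  qed
qed

end
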